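(* Let $\mathscr{T}$ be a T-mesh, let $\mathrm{ext}_s(\mathscr{T})$ be an extended T-mesh of $\mathscr{T}$, let $n=\dim S_{d_1,d_2}(\mathrm{ext}_s(\mathscr{T}))$, and let $\{\mathcal{B}_1,\dots,\mathcal{B}_n\}$ be a basis of $S_{d_1,d_2}(\mathrm{ext}_s(\mathscr{T}))$. Let $Mc=0$, $c=(c_1,\dots,c_n)\in\mathbb{R}^n$, be the homogeneous linear system given by the Extended Edge Elimination (EEE) conditions. If $\{\tilde c_j\}_{j=1}^h$, with $\tilde c_j=(\tilde c_{1,j},\dots,\tilde c_{n,j})$, is a basis of the solution space of this system, then the functions $$\left\{\sum_{i=1}^n\tilde c_{i,j}\,\mathcal{B}_i\right\}_{j=1}^h$$ form a basis of $S_{d_1,d_2}(\mathscr{T})$; consequently $h=\dim S_{d_1,d_2}(\mathscr{T})$.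
   Context: **T-meshes.** A T-mesh $\mathscr{T}=\{C_i\}_{i\in I}$ is a finite collection of axis-aligned rectangles (cells), any two distinct ones meeting only at points of their edges, with connected union $\Omega$. Grid points are vertices; an interior vertex that is the intersection of three cells is a T-node. An edge is a segment joining two adjacent vertices on a grid line. An $l$-edge is a longest possible segment made of (interior) edges; its endpoints are T-nodes or boundary vertices. It is a T $l$-edge if both endpoints are T-nodes, and a ray if one endpoint is a T-node and the other a boundary vertex. **Spline space.** For $d_1,d_2\ge1$, $S_{d_1,d_2}(\mathscr{T})$ is the space of functions $s$ on $\Omega$ that are of class $C^{d_1-1,d_2-1}(\Omega)$ (continuity order $d_1-1$ in $x$ and $d_2-1$ in $y$) and whose restriction to each cell is a bivariate polynomial of degree at most $d_1$ in $x$ and at most $d_2$ in $y$. **Extension.** $\mathscr{T}_1$ is an extension of $\mathscr{T}$ if it is obtained from $\mathscr{T}$ by extending rays or T $l$-edges of $\mathscr{T}$ (prolonging them beyond their T-node endpoints across cells of the mesh, so that $\Omega$ is unchanged); one writes $\mathscr{T}_1=\mathrm{ext}_s(\mathscr{T})$, where $s$ is the number of added (extended) edges. The extended edges $e_1,\dots,e_s$ are the edges of $\mathrm{ext}_s(\mathscr{T})$ that do not belong to $\mathscr{T}$ (do not lie on edges of $\mathscr{T}$). **EEE conditions.** For a horizontal extended edge $e$, lying on $y=y_k$, the condition on $c=(c_1,\dots,c_n)$ is $$\frac{\partial_+^{d_2}}{\partial y^{d_2}}\Big(\sum_{i=1}^nc_i\mathcal{B}_i\Big)\Big|_e\equiv\frac{\partial_-^{d_2}}{\partial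 y^{d_2}}\Big(\sum_{i=1}^nc_i\mathcal{B}_i\Big)\Big|_e ,$$ where $\partial_\pm$ denote the one-sided derivatives from above and below; for a vertical extended edge $e$, lying on $x=x_k$, it is the same condition with $\partial_\pm^{d_1}/\partial x^{d_1}$ (one-sided derivatives from the right and left). These conditions for all $e_1,\dots,e_s$ together form the linear system $Mc\equiv0$, where $M(i,j)=\big(\tfrac{\partial_+^{d_2}}{\partial y^{d_2}}-\tfrac{\partial_-^{d_2}}{\partial y^{d_2}}\big)\mathcal{B}_j|_{e_i}$ is a polynomial in $x$ of degree at most $d_1$ if $e_i$ is horizontal, and $M(i,j)=\big(\tfrac{\partial_+^{d_1}}{\partial x^{d_1}}-\tfrac{\partial_-^{d_1}}{\partial x^{d_1}}\big)\mathcal{B}_j|_{e_i}$ is a polynomial in $y$ of degree at most $d_2$ if $e_i$ is vertical. The unknowns $c_i$ are real constants and each row is required to hold identically as a polynomial. *)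

theory Defs
  imports "HOL-Analysis.Analysis" "HOL-Library.Function_Algebras"
begin

section \<open>Real vector spaces of functions\<close>

instantiation "fun" :: (type, real_vector) real_vector
begin

definition scaleR_fun :: "real \<Rightarrow> ('a \<Rightarrow> 'b) \<Rightarrow> 'a \<Rightarrow> 'b" where
  "scaleR_fun r f = (\<lambda>x. r *\<^sub>R f x)"

instance
  by standard (simp_all add: scaleR_fun_def fun_eq_iff scaleR_add_right scaleR_add_left)

end

lemma scaleR_fun_apply [simp]: "(r *\<^sub>R f) x = r *\<^sub>R f x"
  by (simp add: scaleR_fun_def)

text \<open>The family \<open>b 0, \<dots>, b (m - 1)\<close> is a basis of \<open>V\<close>.\<close>

definition basis_family :: "nat \<Rightarrow> (nat \<Rightarrow> 'v::real_vector) \<Rightarrow> 'v set \<Rightarrow> bool" where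
  "basis_family m b V \<longleftrightarrow>
     inj_on b {..<m} \<and> independent (b ` {..<m}) \<and> span (b ` {..<m}) = V"


section \<open>T-meshes\<close>

type_synonym mesh = "(real \<times> real) set set"

definition cell :: "(real \<times> real) set \<Rightarrow> bool" where
  "cell C \<longleftrightarrow> (\<exists>a b c d. a < b \<and> c < d \<and> C = {a..b} \<times> {c..d})"

definition T_mesh :: "mesh \<Rightarrow> bool" where
  "T_mesh T \<longleftrightarrow> finite T \<and> T \<noteq> {} \<and> (\<forall>C\<in>T. cell C) \<and>
     (\<forall>C\<in>T. \<forall>D\<in>T. C \<noteq> D \<longrightarrow> C \<inter> D \<subseteq> frontier C \<inter> frontier D) \<and>
     connected (\<Union>T)"

definition grid :: "mesh \<Rightarrow> (real \<times> real) set" where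
  "grid T = (\<Union>C\<in>T. frontier C)"

definition vertices :: "mesh \<Rightarrow> (real \<times> real) set" where
  "vertices T = {(x, y). \<exists>a b c d. a < b \<and> c < d \<and> {a..b} \<times> {c..d} \<in> T \<and>
                   x \<in> {a, b} \<and> y \<in> {c, d}}"

definition boundary_vertex :: "mesh \<Rightarrow> real \<times> real \<Rightarrow> bool" where
  "boundary_vertex T v \<longleftrightarrow> v \<in> vertices T \<and> v \<in> frontier (\<Union>T)"

definition T_node :: "mesh \<Rightarrow> real \<times> real \<Rightarrow> bool" where
  "T_node T v \<longleftrightarrow> v \<in> vertices T \<and> v \<in> interior (\<Union>T) \<and> card {C \<in> T. v \<in> C} = 3"

definition edges :: "mesh \<Rightarrow> (real \<times> real) set set" where
  "edges T = {closed_segment v w | v w.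
     v \<in> vertices T \<and> w \<in> vertices T \<and> v \<noteq> w \<and> (fst v = fst w \<or> snd v = snd w) \<and>
     closed_segment v w \<subseteq> grid T \<and> open_segment v w \<inter> vertices T = {}}"

definition interior_edges :: "mesh \<Rightarrow> (real \<times> real) set set" where
  "interior_edges T = {e \<in> edges T. \<not> e \<subseteq> frontier (\<Union>T)}"

definition edge_chain :: "mesh \<Rightarrow> real \<times> real \<Rightarrow> real \<times> real \<Rightarrow> bool" where
  "edge_chain T p q \<longleftrightarrow> p \<noteq> q \<and> (\<exists>E \<subseteq> interior_edges T. closed_segment p q = \<Union>E)"

definition l_edge :: "mesh \<Rightarrow> real \<times> real \<Rightarrow> real \<times> real \<Rightarrow> bool" where
  "l_edge T p q \<longleftrightarrow> edge_chain T p q \<and>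
     (\<forall>p' q'. edge_chain T p' q' \<and> closed_segment p q \<subseteq> closed_segment p' q' \<longrightarrow>
        closed_segment p' q' = closed_segment p q)"

definition T_l_edge :: "mesh \<Rightarrow> real \<times> real \<Rightarrow> real \<times> real \<Rightarrow> bool" where
  "T_l_edge T p q \<longleftrightarrow> l_edge T p q \<and> T_node T p \<and> T_node T q"

definition ray :: "mesh \<Rightarrow> real \<times> real \<Rightarrow> real \<times> real \<Rightarrow> bool" where
  "ray T p q \<longleftrightarrow> l_edge T p q \<and>
     (T_node T p \<and> boundary_vertex T q \<or> boundary_vertex T p \<and> T_node T q)"


section \<open>Extensions\<close>

text \<open>
  \<open>[p, q]\<close> prolongs a ray or T l-edge \<open>[r, p]\<close> beyond its T-node \<open>p\<close>. As l-edges consist of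
  interior edges, the prolongation must stay inside the domain, except that \<open>q\<close> may be a
  boundary point.
\<close>

definition prolongation :: "mesh \<Rightarrow> real \<times> real \<Rightarrow> real \<times> real \<Rightarrow> bool" where
  "prolongation T p q \<longleftrightarrow> T_node T p \<and> q \<in> \<Union>T \<and> open_segment p q \<subseteq> interior (\<Union>T) \<and>
     (\<exists>r. (ray T r p \<or> T_l_edge T r p) \<and> p \<in> open_segment r q)"

text \<open>
  Since \<open>T'\<close> is itself a T-mesh, the grid equation forces every prolongation to end on a grid
  line of \<open>T'\<close>. A prolongation may run over existing edges of \<open>T\<close>.
\<close>

definition is_extension :: "mesh \<Rightarrow> mesh \<Rightarrow> bool" where
  "is_extension T T' \<longleftrightarrow> T_mesh T' \<and> \<Union>T' = \<Union>T \<and>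
     (\<exists>P. finite P \<and> (\<forall>(p, q)\<in>P. prolongation T p q) \<and>
        grid T' = grid T \<union> (\<Union>(p, q)\<in>P. closed_segment p q))"

definition extended_edges :: "mesh \<Rightarrow> mesh \<Rightarrow> (real \<times> real) set set" where
  "extended_edges T T' = {e \<in> edges T'. \<not> (\<exists>e' \<in> edges T. e \<subseteq> e')}"


section \<open>Spline spaces\<close>

text \<open>
  All partial derivatives of order at most \<open>a\<close> in \<open>x\<close> and at most \<open>b\<close> in \<open>y\<close> exist on \<open>\<Omega>\<close>
  (taken relative to \<open>\<Omega>\<close>, hence one-sided where \<open>\<Omega>\<close> requires it) and are continuous on \<open>\<Omega>\<close>;
  \<open>D i j\<close> is the derivative of order \<open>i\<close> in \<open>x\<close> and \<open>j\<close> in \<open>y\<close>.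
\<close>

definition C_class :: "nat \<Rightarrow> nat \<Rightarrow> (real \<times> real) set \<Rightarrow> (real \<times> real \<Rightarrow> real) \<Rightarrow> bool" where
  "C_class a b \<Omega> f \<longleftrightarrow> (\<exists>D :: nat \<Rightarrow> nat \<Rightarrow> real \<times> real \<Rightarrow> real.
     D 0 0 = f \<and>
     (\<forall>i\<le>a. \<forall>j\<le>b. continuous_on \<Omega> (D i j)) \<and>
     (\<forall>i<a. \<forall>j\<le>b. \<forall>(x, y)\<in>\<Omega>.
        ((\<lambda>t. D i j (t, y)) has_real_derivative D (Suc i) j (x, y)) (at x within {t. (t, y) \<in> \<Omega>})) \<and>
     (\<forall>i\<le>a. \<forall>j<b. \<forall>(x, y)\<in>\<Omega>.
        ((\<lambda>t. D i j (x, t)) has_real_derivative D i (Suc j) (x, y)) (at y within {t. (x, t) \<in> \<Omega>})))"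

definition bipoly_on :: "nat \<Rightarrow> nat \<Rightarrow> (real \<times> real) set \<Rightarrow> (real \<times> real \<Rightarrow> real) \<Rightarrow> bool" where
  "bipoly_on d1 d2 C f \<longleftrightarrow>
     (\<exists>a. \<forall>(x, y)\<in>C. f (x, y) = (\<Sum>i\<le>d1. \<Sum>j\<le>d2. a i j * x ^ i * y ^ j))"

text \<open>
  A function on the domain \<open>\<Union>T\<close> is represented by its extension by \<open>0\<close> to the whole plane.
\<close>

definition spline_space :: "nat \<Rightarrow> nat \<Rightarrow> mesh \<Rightarrow> (real \<times> real \<Rightarrow> real) set" where
  "spline_space d1 d2 T = {f. (\<forall>p. p \<notin> \<Union>T \<longrightarrow> f p = 0) \<and>
     C_class (d1 - 1) (d2 - 1) (\<Union>T) f \<and> (\<forall>C\<in>T. bipoly_on d1 d2 C f)}"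


section \<open>Extended edge elimination\<close>

text \<open>
  One-sided derivatives of order \<open>k\<close>, as iterated one-sided derivatives; for functions that are
  polynomial on each side they are the derivatives of the two polynomial pieces.
\<close>

definition right_deriv :: "nat \<Rightarrow> (real \<Rightarrow> real) \<Rightarrow> real \<Rightarrow> real" where
  "right_deriv k g = ((\<lambda>u t. vector_derivative u (at_right t)) ^^ k) g"

definition left_deriv :: "nat \<Rightarrow> (real \<Rightarrow> real) \<Rightarrow> real \<Rightarrow> real" where
  "left_deriv k g = ((\<lambda>u t. vector_derivative u (at_left t)) ^^ k) g"

definition horizontal :: "(real \<times> real) set \<Rightarrow> bool" where
  "horizontal e \<longleftrightarrow> (\<exists>k. \<forall>p\<in>e. snd p = k)"

text \<open>
  The jump of \<open>f\<close> across the edge \<open>e\<close>, as a function of the point on \<open>e\<close>: in the derivative of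
  order \<open>d2\<close> in \<open>y\<close> if \<open>e\<close> is horizontal, of order \<open>d1\<close> in \<open>x\<close> if \<open>e\<close> is vertical.
\<close>

fun jump :: "nat \<Rightarrow> nat \<Rightarrow> (real \<times> real) set \<Rightarrow> (real \<times> real \<Rightarrow> real) \<Rightarrow> real \<times> real \<Rightarrow> real" where
  "jump d1 d2 e f (x, y) =
     (if horizontal e
      then right_deriv d2 (\<lambda>t. f (x, t)) y - left_deriv d2 (\<lambda>t. f (x, t)) y
      else right_deriv d1 (\<lambda>t. f (t, y)) x - left_deriv d1 (\<lambda>t. f (t, y)) x)"

definition EEE_matrix ::
  "nat \<Rightarrow> nat \<Rightarrow> (nat \<Rightarrow> (real \<times> real) set) \<Rightarrow> (nat \<Rightarrow> real \<times> real \<Rightarrow> real) \<Rightarrow>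
   nat \<Rightarrow> nat \<Rightarrow> real \<times> real \<Rightarrow> real" where
  "EEE_matrix d1 d2 e B i j = jump d1 d2 (e i) (B j)"

text \<open>
  A vector in \<open>\<real>\<^sup>n\<close> is a function \<open>nat \<Rightarrow> real\<close> vanishing outside \<open>{..<n}\<close>. Row \<open>i\<close> of the
  system has to hold identically on the edge \<open>e i\<close>.
\<close>

definition EEE_solutions ::
  "nat \<Rightarrow> nat \<Rightarrow> nat \<Rightarrow> (nat \<Rightarrow> (real \<times> real) set) \<Rightarrow> nat \<Rightarrow> (nat \<Rightarrow> real \<times> real \<Rightarrow> real) \<Rightarrow>
   (nat \<Rightarrow> real) set" where
  "EEE_solutions d1 d2 s e n B = {c. (\<forall>j\<ge>n. c j = 0) \<and>
     (\<forall>i<s. \<forall>p\<in>e i. (\<Sum>j<n. EEE_matrix d1 d2 e B i j p * c j) = 0)}"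

end

theory Submission
  imports Defs "HOL-Computational_Algebra.Polynomial"
begin

text \<open>
  The extended mesh refines the original one, and an extended edge lies in a single cell \<open>C\<close> of the
  original mesh, with its relative interior in the interior of \<open>C\<close>. A spline on the coarse mesh is one
  polynomial on \<open>C\<close>, so it has no jump across the edge. Conversely, let \<open>f\<close> be a spline on the extended
  mesh all of whose jumps vanish. Two polynomial pieces that meet along an edge inside \<open>C\<close> have the same
  normal derivatives of order less than \<open>d\<close> by smoothness and of order \<open>d\<close> because the jump is zero;
  as their degree in that direction is at most \<open>d\<close>, they coincide. So \<open>f\<close> is locally a polynomial on the
  interior of \<open>C\<close> minus finitely many vertices, a connected set, and hence one polynomial on \<open>C\<close>.
  Thus \<open>c \<mapsto> \<Sum>i. c i *\<^sub>R B i\<close> maps the solution space of the system isomorphically onto the coarse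
  spline space.
\<close>

subsection \<open>Cells and grids\<close>

lemma frontier_closed_eq: "closed C \<Longrightarrow> frontier C = C - interior C"
  by (simp add: frontier_def)

lemma
  assumes "cell C"
  shows cell_closed: "closed C" and cell_convex: "convex C"
    and cell_interior_nonempty: "interior C \<noteq> {}"
    and cell_closure_interior: "closure (interior C) = C"
    and cell_interior_connected: "connected (interior C)"
proof -
  obtain a b c d where ab: "a < b" "c < d" and C: "C = {a..b} \<times> {c..d}"
    using assms unfolding cell_def by blast
  show "closed C" "convex C" unfolding C by (auto intro: closed_Times convex_Times)
  have I: "interior C = {a<..<b} \<times> {c<..<d}"
    by (simp add: C interior_Times)
  show "interior C \<noteq> {}" "closure (interior C) = C" "connected (interior C)"
    using ab unfolding I by (auto simp: C closure_Times intro!: connected_Times)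
qed

lemma interior_rectangle:
  "interior ({a..b} \<times> {c..d}) = {a<..<b::real} \<times> {c<..<d::real}"
  by (simp add: interior_Times)

lemma frontier_rectangle:
  "frontier ({a..b} \<times> {c..d}) = {a..b} \<times> {c..d} - {a<..<b::real} \<times> {c<..<d::real}"
  by (simp add: frontier_closed_eq closed_Times interior_rectangle)

lemma rectangle_eq_iff:
  fixes a b c d :: real
  assumes "a < b" "c < d"
  shows "{a..b} \<times> {c..d} = {a'..b'} \<times> {c'..d'} \<longleftrightarrow> a = a' \<and> b = b' \<and> c = c' \<and> d = d'"
  using assms by (auto simp: times_eq_iff Icc_eq_Icc)

lemma vertices_rectangleI:
  "\<lbrakk>{a..b} \<times> {c..d} \<in> T; a < b; c < d; x = a \<or> x = b; y = c \<or> y = d\<rbrakk> \<Longrightarrow> (x, y) \<in> vertices T"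
  unfolding vertices_def by auto

lemma T_mesh_cell: "T_mesh T \<Longrightarrow> C \<in> T \<Longrightarrow> cell C"
  by (simp add: T_mesh_def)

lemma T_mesh_finite: "T_mesh T \<Longrightarrow> finite T"
  by (simp add: T_mesh_def)

lemma finite_vertices:
  assumes "T_mesh T"
  shows "finite (vertices T)"
proof -
  \<comment> \<open>The corners contributed by one cell. A nondegenerate rectangle determines its
    bounds, so there are at most four of them.\<close>
  define K :: "(real \<times> real) set \<Rightarrow> (real \<times> real) set" where
    "K C = {(x, y). \<exists>a b c d. a < b \<and> c < d \<and> C = {a..b} \<times> {c..d} \<and> x \<in> {a, b} \<and> y \<in> {c, d}}" for C
  have "finite (K C)" if CT: "C \<in> T" for C
  proof -
    obtain a b c d where ab: "a < b" "c < d" and C: "C = {a..b} \<times> {c..d}"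
      using T_mesh_cell[OF assms CT] unfolding cell_def by blast
    have "K C \<subseteq> {a, b} \<times> {c, d}"
      unfolding K_def C rectangle_eq_iff[OF ab] by auto
    then show ?thesis by (rule finite_subset) simp
  qed
  then have fin: "finite (\<Union>C\<in>T. K C)" using T_mesh_finite[OF assms] by simp
  show ?thesis
  proof (rule finite_subset[OF _ fin], rule subrelI)
    fix x y assume "(x, y) \<in> vertices T"
    then obtain a b c d where "a < b" "c < d" "{a..b} \<times> {c..d} \<in> T" "x \<in> {a, b}" "y \<in> {c, d}"
      unfolding vertices_def by blast
    moreover from this have "(x, y) \<in> K ({a..b} \<times> {c..d})" unfolding K_def by blast
    ultimately show "(x, y) \<in> (\<Union>C\<in>T. K C)" by blast
  qed
qed

lemma cell_unique:
  assumes "T_mesh T" "C \<in> T" "D \<in> T" "p \<in> interior C" "p \<in> D"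
  shows "D = C"
proof (rule ccontr)
  assume "D \<noteq> C"
  then have "C \<inter> D \<subseteq> frontier C" using assms(1-3) unfolding T_mesh_def by fast
  moreover have "p \<in> C" using assms(4) interior_subset by blast
  ultimately show False using assms(4,5) by (auto simp: frontier_def)
qed

lemma grid_disjoint_interior:
  assumes "T_mesh T" "C \<in> T"
  shows "interior C \<inter> grid T = {}"
proof -
  have "p \<notin> frontier D" if "p \<in> interior C" "D \<in> T" for p D
  proof
    assume p: "p \<in> frontier D"
    then have "p \<in> D"
      using cell_closed[OF T_mesh_cell[OF assms(1) that(2)]] frontier_closed_eq by auto
    then have "D = C" using cell_unique[OF assms that(2,1)] by blast
    then show False using that(1) p by (simp add: frontier_def)
  qed
  then show ?thesis unfolding grid_def by blast
qed

lemma grid_subset_Union: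
  assumes "T_mesh T"
  shows "grid T \<subseteq> \<Union>T"
  using cell_closed[OF T_mesh_cell[OF assms]] frontier_subset_closed unfolding grid_def by blast

lemma vertices_subset_grid:
  "vertices T \<subseteq> grid T"
  unfolding vertices_def grid_def by (fastforce simp: frontier_rectangle)

lemma mem_interior_if_not_grid:
  assumes "p \<in> C" "C \<in> T" "p \<notin> grid T"
  shows "p \<in> interior C"
  using assms closure_subset unfolding grid_def frontier_def by blast

text \<open>A connected set that meets a cell but not its frontier cannot leave it. This places sets
  that avoid the coarse grid, such as the interior of a fine cell or the relative interior of an
  extended edge, in a single coarse cell.\<close>

lemma connected_subset_interior:
  assumes "T_mesh T" "connected S" "S \<noteq> {}" "S \<subseteq> \<Union>T" "S \<inter> grid T = {}"
  shows "\<exists>C\<in>T. S \<subseteq> interior C"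
proof -
  obtain p C where p: "p \<in> S" "C \<in> T" "p \<in> C" using assms by blast
  have "S \<inter> frontier C = {}" using assms(5) p unfolding grid_def by blast
  then have "S \<subseteq> C" using connected_Int_frontier[OF assms(2), of C] p by blast
  then have "S \<subseteq> interior C" using mem_interior_if_not_grid[OF _ p(2)] assms(5) by blast
  then show ?thesis using p by blast
qed

text \<open>If no cell contains an initial piece of the ray, each cell is avoided by all
  sufficiently small positive parameters: a cell through \<open>m\<close> by convexity, any other
  cell because it is closed. As there are finitely many cells, a common small parameter yields a
  point of the ray outside the domain.\<close>

lemma ray_in_cell:
  fixes m v :: "real \<times> real"
  assumes "finite T" "\<And>C. C \<in> T \<Longrightarrow> cell C" "\<delta> > 0"
    and "\<And>t. 0 \<le> t \<Longrightarrow> t \<le> \<delta> \<Longrightarrow> m + t *\<^sub>R v \<in> \<Union>T"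
  shows "\<exists>D\<in>T. \<exists>\<epsilon>>0. \<forall>t\<in>{0..\<epsilon>}. m + t *\<^sub>R v \<in> D"
proof (rule ccontr)
  assume neg: "\<not> ?thesis"
  have "\<forall>\<^sub>F t in at_right 0. m + t *\<^sub>R v \<notin> D" if D: "D \<in> T" for D
  proof (cases "m \<in> D")
    case True
    have "m + t *\<^sub>R v \<notin> D" if "t > 0" for t
    proof
      assume mt: "m + t *\<^sub>R v \<in> D"
      \<comment> \<open>One later point of the ray in \<open>D\<close> brings the whole segment from
        \<open>m\<close> into \<open>D\<close>, which the assumption \<open>neg\<close>
        excludes.\<close>
      have "m + s *\<^sub>R v \<in> D" if s: "s \<in> {0..t}" for s
      proof -
        have "(1 - s / t) *\<^sub>R m + (s / t) *\<^sub>R (m + t *\<^sub>R v) \<in> D"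
          using s \<open>t > 0\<close> by (intro convexD_alt cell_convex assms D True mt) auto
        also have "(1 - s / t) *\<^sub>R m + (s / t) *\<^sub>R (m + t *\<^sub>R v) = m + s *\<^sub>R v"
          using \<open>t > 0\<close> by (simp add: algebra_simps)
        finally show ?thesis .
      qed
      then show False using neg D \<open>t > 0\<close> by blast
    qed
    then show ?thesis by (simp add: eventually_at_right_less eventually_at_filter)
  next
    case False
    have "((\<lambda>t. m + t *\<^sub>R v) \<longlongrightarrow> m + 0 *\<^sub>R v) (at_right 0)"
      by (intro tendsto_intros)
    moreover have "open (- D)" using cell_closed[OF assms(2)[OF D]] by auto
    ultimately have "\<forall>\<^sub>F t in at_right 0. m + t *\<^sub>R v \<in> - D"
      using False by (auto dest!: topological_tendstoD)
    then show ?thesis by simp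
  qed
  then have "\<forall>\<^sub>F t in at_right 0. \<forall>D\<in>T. m + t *\<^sub>R v \<notin> D"
    using assms(1) by (simp add: eventually_ball_finite)
  moreover have "\<forall>\<^sub>F t in at_right (0::real). t < \<delta> \<and> t > 0"
    using assms(3) by (auto simp: eventually_at_right_field)
  ultimately have "\<forall>\<^sub>F t in at_right (0::real). False"
  proof eventually_elim
    case (elim t)
    then have "m + t *\<^sub>R v \<in> \<Union>T" by (intro assms(4)) auto
    with elim show False by blast
  qed
  then show False by (simp add: trivial_limit_at_right_real)
qed

text \<open>Induction on the number of vertices strictly inside the segment. With none left the
  segment is an edge; otherwise it is split at such a vertex \<open>u\<close>, and the half
  containing \<open>m\<close> has fewer inner vertices, since \<open>u\<close> becomes an
  endpoint.\<close>

lemma edge_in_segment: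
  assumes "finite (vertices T)" "v \<in> vertices T" "w \<in> vertices T" "v \<noteq> w"
    and "fst v = fst w \<or> snd v = snd w" "closed_segment v w \<subseteq> grid T"
    and "m \<in> open_segment v w" "m \<notin> vertices T"
  shows "\<exists>v' w'. closed_segment v' w' \<in> edges T \<and> v' \<in> vertices T \<and> w' \<in> vertices T \<and>
    m \<in> open_segment v' w' \<and> closed_segment v' w' \<subseteq> closed_segment v w"
  using assms(2-)
proof (induction "card (open_segment v w \<inter> vertices T)" arbitrary: v w rule: less_induct)
  case less
  show ?case
  proof (cases "open_segment v w \<inter> vertices T = {}")
    case True
    then have "closed_segment v w \<in> edges T" using less.prems unfolding edges_def by blast
    then show ?thesis using less.prems by blast
  next
    case False
    then obtain u where u: "u \<in> open_segment v w" "u \<in> vertices T" by blast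
    have uc: "u \<in> closed_segment v w" using u by (simp add: open_segment_def)
    have ul: "open_segment v u \<subseteq> open_segment v w" "open_segment u w \<subseteq> open_segment v w"
      "closed_segment v u \<subseteq> closed_segment v w" "closed_segment u w \<subseteq> closed_segment v w"
      using uc by (simp_all add: subset_open_segment subset_closed_segment)
    have un: "u \<notin> open_segment v u" "u \<notin> open_segment u w"
      by (simp_all add: open_segment_def)
    have lt: "card (open_segment v u \<inter> vertices T) < card (open_segment v w \<inter> vertices T)"
      "card (open_segment u w \<inter> vertices T) < card (open_segment v w \<inter> vertices T)"
      using ul un u assms(1) by (auto intro!: psubset_card_mono)
    obtain t where t: "u = (1 - t) *\<^sub>R v + t *\<^sub>R w"
      using uc by (auto simp: in_segment)
    have ax: "fst v = fst u \<or> snd v = snd u" "fst u = fst w \<or> snd u = snd w"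
      using less.prems(4) unfolding t by (auto simp: algebra_simps)
    have "m \<in> open_segment v u \<or> m \<in> open_segment u w"
      using Un_open_segment[OF u(1)] less.prems u by blast
    then show ?thesis
    proof
      assume m: "m \<in> open_segment v u"
      then have "v \<noteq> u" by auto
      from less.hyps[OF lt(1) less.prems(1) u(2) this ax(1) _ m less.prems(7)]
      show ?thesis using ul less.prems(5) by (meson subset_trans)
    next
      assume m: "m \<in> open_segment u w"
      then have "u \<noteq> w" by auto
      from less.hyps[OF lt(2) u(2) less.prems(2) this ax(2) _ m less.prems(7)]
      show ?thesis using ul less.prems(5) by (meson subset_trans)
    qed
  qed
qed

section \<open>Axis-parallel segments, crossings of grid lines, and edges on the sides of
  cells\<close>

lemma horizontal_segment:
  fixes u v y :: real
  assumes "u < v"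
  shows "closed_segment (u, y) (v, y) = {u..v} \<times> {y}"
    and "open_segment (u, y) (v, y) = {u<..<v} \<times> {y}"
proof -
  have 0: "{(u, y), (v, y)} = {u, v} \<times> {y}" by auto
  have "closed_segment (u, y) (v, y) = closed_segment u v \<times> {y}"
    using arg_cong[OF 0, of "(hull) convex"]
    unfolding convex_hull_Times convex_hull_singleton segment_convex_hull .
  then show *: "closed_segment (u, y) (v, y) = {u..v} \<times> {y}"
    unfolding closed_segment_eq_real_ivl1[OF less_imp_le[OF assms]] .
  show "open_segment (u, y) (v, y) = {u<..<v} \<times> {y}"
    unfolding open_segment_def * 0 by (auto simp: less_le)
qed

lemma vertical_segment:
  fixes u v x :: real
  assumes "u < v"
  shows "closed_segment (x, u) (x, v) = {x} \<times> {u..v}"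
    and "open_segment (x, u) (x, v) = {x} \<times> {u<..<v}"
proof -
  have 0: "{(x, u), (x, v)} = {x} \<times> {u, v}" by auto
  have "closed_segment (x, u) (x, v) = {x} \<times> closed_segment u v"
    using arg_cong[OF 0, of "(hull) convex"]
    unfolding convex_hull_Times convex_hull_singleton segment_convex_hull .
  then show *: "closed_segment (x, u) (x, v) = {x} \<times> {u..v}"
    unfolding closed_segment_eq_real_ivl1[OF less_imp_le[OF assms]] .
  show "open_segment (x, u) (x, v) = {x} \<times> {u<..<v}"
    unfolding open_segment_def * 0 by (auto simp: less_le)
qed

lemma grid_rectangleI:
  assumes "{a..b} \<times> {c..d} \<in> T" "(x, y) \<in> {a..b} \<times> {c..d}" "x = a \<or> x = b \<or> y = c \<or> y = d"
  shows "(x, y) \<in> grid T"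
  using assms unfolding grid_def by (intro UN_I[OF assms(1)]) (auto simp: frontier_rectangle)

lemma not_grid_rectangle:
  assumes "T_mesh T" "{a..b} \<times> {c..d} \<in> T" "a < x" "x < b" "c < y" "y < d"
  shows "(x, y) \<notin> grid T"
proof -
  have "(x, y) \<in> {a<..<b} \<times> {c<..<d}" using assms(3-) by auto
  then show ?thesis using grid_disjoint_interior[OF assms(1,2)] by (simp add: interior_rectangle disjoint_iff)
qed

lemma grid_rectangleE:
  assumes "T_mesh T" "(x, y) \<in> grid T"
  obtains a b c d where "{a..b} \<times> {c..d} \<in> T" "a < b" "c < d" "(x, y) \<in> {a..b} \<times> {c..d}"
    "x = a \<or> x = b \<or> y = c \<or> y = d"
proof -
  obtain C where C: "C \<in> T" "(x, y) \<in> frontier C" using assms(2) unfolding grid_def by blast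
  then obtain a b c d where "a < b" "c < d" "C = {a..b} \<times> {c..d}"
    using T_mesh_cell[OF assms(1) C(1)] unfolding cell_def by blast
  then show ?thesis using C by (intro that[of a b c d]) (auto simp: frontier_rectangle)
qed

text \<open>Take a cell with the point on its frontier. If the point is not a corner, it lies in the
  relative interior of a side; the grid segment perpendicular to that side extends to both sides of
  the point and so enters the interior of the cell, where no grid point can lie.\<close>

lemma crossing_is_vertex:
  assumes T: "T_mesh T"
    and x: "x1 < x" "x < x2" "{x1..x2} \<times> {y} \<subseteq> grid T"
    and y: "y1 < y" "y < y2" "{x} \<times> {y1..y2} \<subseteq> grid T"
  shows "(x, y) \<in> vertices T"
proof (rule ccontr)
  assume nv: "(x, y) \<notin> vertices T"
  have "(x, y) \<in> grid T" using x by auto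
  then obtain a b c d where D: "{a..b} \<times> {c..d} \<in> T" "a < b" "c < d"
      "(x, y) \<in> {a..b} \<times> {c..d}" and side: "x = a \<or> x = b \<or> y = c \<or> y = d"
    using grid_rectangleE[OF T] by metis
  have nv': "\<not> ((x = a \<or> x = b) \<and> (y = c \<or> y = d))"
    using nv vertices_rectangleI[OF D(1-3)] by blast
  have no: "\<not> (a < s \<and> s < b \<and> c < t \<and> t < d)" if "(s, t) \<in> grid T" for s t
    using not_grid_rectangle[OF T D(1)] that by blast
  have h: "(s, y) \<in> grid T" if "x1 \<le> s" "s \<le> x2" for s using x(3) that by auto
  have v: "(x, t) \<in> grid T" if "y1 \<le> t" "t \<le> y2" for t using y(3) that by auto
  show False
  proof (cases "x = a \<or> x = b")
    case True
    then have cd: "c < y" "y < d" using D(4) nv' by auto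
    from True show False
    proof
      assume "x = a"
      \<comment> \<open>The point \<open>(s, y)\<close> lies on the given horizontal grid segment
        and inside the cell. The other three cases choose such a point in the same way.\<close>
      with x D(2) obtain s where "a < s" "s < min b x2" using dense[of a "min b x2"] by auto
      with no[OF h[of s]] cd x \<open>x = a\<close> show False by auto
    next
      assume "x = b"
      with x D(2) obtain s where "max a x1 < s" "s < b" using dense[of "max a x1" b] by auto
      with no[OF h[of s]] cd x \<open>x = b\<close> show False by auto
    qed
  next
    case False
    then have ab: "a < x" "x < b" and "y = c \<or> y = d" using D(4) side by auto
    then show False
    proof (elim disjE)
      assume "y = c"
      with y D(3) obtain s where "c < s" "s < min d y2" using dense[of c "min d y2"] by auto
      with no[OF v[of s]] ab y \<open>y = c\<close> show False by auto
    next
      assume "y = d"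
      with y D(3) obtain s where "max c y1 < s" "s < d" using dense[of "max c y1" d] by auto
      with no[OF v[of s]] ab y \<open>y = d\<close> show False by auto
    qed
  qed
qed

text \<open>A side of a cell may carry further vertices, coming from cells on its other side, so it
  need not be an edge itself. The edge around the point is cut out of the side by
  \<open>edge_in_segment\<close>.\<close>

lemma horizontal_side_edge:
  assumes T: "T_mesh T" and D: "{a..b} \<times> {c..d} \<in> T" "c < d" and y: "y = c \<or> y = d"
    and x: "a < x" "x < b" and nv: "(x, y) \<notin> vertices T"
  obtains u v where "{u..v} \<times> {y} \<in> edges T" "u < x" "x < v" "(u, y) \<in> vertices T"
    "(v, y) \<in> vertices T"
proof -
  have ab: "a < b" using x by simp
  have "{a..b} \<times> {y} \<subseteq> grid T"
    using y D by (auto intro!: grid_rectangleI[OF D(1)])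
  then obtain p q where pq: "closed_segment p q \<in> edges T" "p \<in> vertices T" "q \<in> vertices T"
      "(x, y) \<in> open_segment p q" "closed_segment p q \<subseteq> {a..b} \<times> {y}"
    using edge_in_segment[OF finite_vertices[OF T] vertices_rectangleI[OF D(1) ab D(2), of a y]
        vertices_rectangleI[OF D(1) ab D(2), of b y], of "(x, y)"] y ab x nv
      horizontal_segment[OF ab]
    by auto
  have "p \<in> {a..b} \<times> {y}" "q \<in> {a..b} \<times> {y}" using pq(5) by auto
  then obtain u v where uv: "p = (u, y)" "q = (v, y)" by auto
  then have "u \<noteq> v" using pq(4) by auto
  then consider "u < v" | "v < u" by linarith
  then show ?thesis
  proof cases
    case 1
    then show ?thesis using pq unfolding uv horizontal_segment[OF 1] by (intro that[of u v]) auto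
  next
    case 2
    then show ?thesis using pq unfolding uv closed_segment_commute[of "(u, y)"]
        open_segment_commute[of "(u, y)"] horizontal_segment[OF 2] by (intro that[of v u]) auto
  qed
qed

lemma vertical_side_edge:
  assumes T: "T_mesh T" and D: "{a..b} \<times> {c..d} \<in> T" "a < b" and x: "x = a \<or> x = b"
    and y: "c < y" "y < d" and nv: "(x, y) \<notin> vertices T"
  obtains u v where "{x} \<times> {u..v} \<in> edges T" "u < y" "y < v" "(x, u) \<in> vertices T"
    "(x, v) \<in> vertices T"
proof -
  have cd: "c < d" using y by simp
  have "{x} \<times> {c..d} \<subseteq> grid T"
    using x D by (auto intro!: grid_rectangleI[OF D(1)])
  then obtain p q where pq: "closed_segment p q \<in> edges T" "p \<in> vertices T" "q \<in> vertices T"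
      "(x, y) \<in> open_segment p q" "closed_segment p q \<subseteq> {x} \<times> {c..d}"
    using edge_in_segment[OF finite_vertices[OF T] vertices_rectangleI[OF D(1) D(2) cd, of x c]
        vertices_rectangleI[OF D(1) D(2) cd, of x d], of "(x, y)"] x cd y nv
      vertical_segment[OF cd]
    by auto
  have "p \<in> {x} \<times> {c..d}" "q \<in> {x} \<times> {c..d}" using pq(5) by auto
  then obtain u v where uv: "p = (x, u)" "q = (x, v)" by auto
  then have "u \<noteq> v" using pq(4) by auto
  then consider "u < v" | "v < u" by linarith
  then show ?thesis
  proof cases
    case 1
    then show ?thesis using pq unfolding uv vertical_segment[OF 1] by (intro that[of u v]) auto
  next
    case 2
    then show ?thesis using pq unfolding uv closed_segment_commute[of "(x, u)"]
        open_segment_commute[of "(x, u)"] vertical_segment[OF 2] by (intro that[of v u]) auto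
  qed
qed

section \<open>The cells around an interior point of the domain\<close>

lemma axis_ray_in_cell:
  assumes T: "T_mesh T" and m: "(x, y) \<in> interior (\<Union>T)"
  obtains a b c d \<epsilon> where "{a..b} \<times> {c..d} \<in> T" "a < b" "c < d" "(x, y) \<in> {a..b} \<times> {c..d}" "\<epsilon> > 0"
    "(x + \<epsilon> * v, y + \<epsilon> * w) \<in> {a..b} \<times> {c..d}"
proof -
  have "((\<lambda>t. (x, y) + t *\<^sub>R (v, w)) \<longlongrightarrow> (x, y) + 0 *\<^sub>R (v, w)) (at_right 0)"
    by (intro tendsto_intros)
  then have "\<forall>\<^sub>F t in at_right 0. (x, y) + t *\<^sub>R (v, w) \<in> interior (\<Union>T)"
    by (rule topological_tendstoD) (use m in \<open>auto simp: zero_prod_def[symmetric]\<close>)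
  then obtain \<delta> where \<delta>: "\<delta> > 0" "\<And>t. 0 < t \<Longrightarrow> t < \<delta> \<Longrightarrow> (x, y) + t *\<^sub>R (v, w) \<in> interior (\<Union>T)"
    by (auto simp: eventually_at_right_field)
  \<comment> \<open>Halving \<open>\<delta>\<close> turns the open range of parameters into the
    closed one required by \<open>ray_in_cell\<close>.\<close>
  have "(x, y) + t *\<^sub>R (v, w) \<in> \<Union>T" if "0 \<le> t" "t \<le> \<delta> / 2" for t
  proof (cases "t = 0")
    case True
    then show ?thesis using m interior_subset[of "\<Union>T"] by (auto simp: zero_prod_def[symmetric])
  next
    case False
    then show ?thesis using \<delta>(1) \<delta>(2)[of t] that interior_subset[of "\<Union>T"] by auto
  qed
  with \<delta>(1) ray_in_cell[OF T_mesh_finite[OF T] T_mesh_cell[OF T], of "\<delta> / 2" "(x, y)" "(v, w)"]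
  obtain D \<epsilon> where D: "D \<in> T" "\<epsilon> > 0" "\<forall>t\<in>{0..\<epsilon>}. (x, y) + t *\<^sub>R (v, w) \<in> D" by auto
  obtain a b c d where "a < b" "c < d" "D = {a..b} \<times> {c..d}"
    using T_mesh_cell[OF T D(1)] unfolding cell_def by blast
  then show ?thesis using D D(3)[rule_format, of 0] D(3)[rule_format, of \<epsilon>]
    by (intro that[of a b c d \<epsilon>]) auto
qed

text \<open>Short axis-parallel rays from a grid point that is no vertex each start inside some
  cell, and the point lies in the relative interior of a side of that cell. Perpendicular sides of
  this kind would cross at the point and make it a vertex, so all the sides found are parallel, and
  the cells on opposite rays face each other.\<close>

lemma interior_point_cases:
  assumes T: "T_mesh T" and m: "(x, y) \<in> interior (\<Union>T)" and nv: "(x, y) \<notin> vertices T"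
  obtains
    (inside) D where "D \<in> T" "(x, y) \<in> interior D"
  | (horizontal) a b c a' b' d' where "{a..b} \<times> {c..y} \<in> T" "{a'..b'} \<times> {y..d'} \<in> T"
      "a < x" "x < b" "a' < x" "x < b'" "c < y" "y < d'"
  | (vertical) a c d b' c' d' where "{a..x} \<times> {c..d} \<in> T" "{x..b'} \<times> {c'..d'} \<in> T"
      "c < y" "y < d" "c' < y" "y < d'" "a < x" "x < b'"
proof (cases "(x, y) \<in> grid T")
  case False
  then show ?thesis using m inside mem_interior_if_not_grid interior_subset by (metis UnionE subsetD)
next
  case True
  have side: "(x = a \<or> x = b) \<and> c < y \<and> y < d \<or> (y = c \<or> y = d) \<and> a < x \<and> x < b"
    if "{a..b} \<times> {c..d} \<in> T" "a < b" "c < d" "(x, y) \<in> {a..b} \<times> {c..d}" for a b c d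
  proof -
    have "\<not> (a < x \<and> x < b \<and> c < y \<and> y < d)"
      using not_grid_rectangle[OF T that(1), of x y] True by blast
    moreover have "\<not> ((x = a \<or> x = b) \<and> (y = c \<or> y = d))"
      using vertices_rectangleI[OF that(1-3), of x y] nv by blast
    moreover have "a < x \<or> x = a" "x < b \<or> x = b" "c < y \<or> y = c" "y < d \<or> y = d"
      using that(4) by auto
    ultimately show ?thesis by argo
  qed
  \<comment> \<open>A cell containing a short vertical piece above the point. The direction of its
    side through the point decides between the two remaining cases.\<close>
  obtain a1 b1 c1 d1 e1 where U: "{a1..b1} \<times> {c1..d1} \<in> T" "a1 < b1" "c1 < d1"
    "(x, y) \<in> {a1..b1} \<times> {c1..d1}" "e1 > 0" "(x + e1 * 0, y + e1 * 1) \<in> {a1..b1} \<times> {c1..d1}"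
    by (rule axis_ray_in_cell[OF T m, of 0 1])
  have side_no_cross: "\<not> ((y = c \<or> y = d) \<and> a < x \<and> x < b \<and> (x = a' \<or> x = b') \<and> c' < y \<and> y < d')"
    if D: "{a..b} \<times> {c..d} \<in> T" "c < d" and D': "{a'..b'} \<times> {c'..d'} \<in> T" "a' < b'" for a b c d a' b' c' d'
  proof
    assume *: "(y = c \<or> y = d) \<and> a < x \<and> x < b \<and> (x = a' \<or> x = b') \<and> c' < y \<and> y < d'"
    have "{a..b} \<times> {y} \<subseteq> grid T" using * D by (auto intro!: grid_rectangleI[OF D(1)])
    moreover have "{x} \<times> {c'..d'} \<subseteq> grid T" using * D' by (auto intro!: grid_rectangleI[OF D'(1)])
    ultimately show False using crossing_is_vertex[OF T] nv * by blast
  qed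
  from side[OF U(1-4)] show ?thesis
  proof
    assume *: "(y = c1 \<or> y = d1) \<and> a1 < x \<and> x < b1"
    \<comment> \<open>The cell contains a point strictly above \<open>(x, y)\<close>, so the side in
      question is its lower one.\<close>
    then have y: "y = c1" using U by auto
    obtain a b c d e where D: "{a..b} \<times> {c..d} \<in> T" "a < b" "c < d"
      "(x, y) \<in> {a..b} \<times> {c..d}" "e > 0" "(x + e * 0, y + e * (-1)) \<in> {a..b} \<times> {c..d}"
      by (rule axis_ray_in_cell[OF T m, of 0 "-1"])
    have "(y = c \<or> y = d) \<and> a < x \<and> x < b"
      using side[OF D(1-4)] side_no_cross[OF U(1,3) D(1,2)] * by blast
    with D * y U show ?thesis by (intro horizontal[of a b c a1 b1 d1]) auto
  next
    assume *: "(x = a1 \<or> x = b1) \<and> c1 < y \<and> y < d1"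
    obtain a b c d e where L: "{a..b} \<times> {c..d} \<in> T" "a < b" "c < d"
      "(x, y) \<in> {a..b} \<times> {c..d}" "e > 0" "(x + e * (-1), y + e * 0) \<in> {a..b} \<times> {c..d}"
      by (rule axis_ray_in_cell[OF T m, of "-1" 0])
    \<comment> \<open>The upper cell has a vertical side through the point, so by
      \<open>side_no_cross\<close> neither the left nor the right cell can have a horizontal one
      there.\<close>
    obtain a' b' c' d' e' where R: "{a'..b'} \<times> {c'..d'} \<in> T" "a' < b'" "c' < d'"
      "(x, y) \<in> {a'..b'} \<times> {c'..d'}" "e' > 0" "(x + e' * 1, y + e' * 0) \<in> {a'..b'} \<times> {c'..d'}"
      by (rule axis_ray_in_cell[OF T m, of 1 0])
    have "(x = a \<or> x = b) \<and> c < y \<and> y < d"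
      using side[OF L(1-4)] side_no_cross[OF L(1,3) U(1,2)] * by blast
    moreover have "(x = a' \<or> x = b') \<and> c' < y \<and> y < d'"
      using side[OF R(1-4)] side_no_cross[OF R(1,3) U(1,2)] * by blast
    ultimately show ?thesis using L R by (intro vertical[of a c d b' c' d']) auto
  qed
qed

subsection \<open>One-sided derivatives of polynomial pieces\<close>

lemma funpow_pderiv_Suc: "(pderiv ^^ Suc k) p = pderiv ((pderiv ^^ k) p)"
  by simp

lemma poly_has_vector_derivative:
  fixes p :: "real poly"
  shows "(poly p has_vector_derivative poly (pderiv p) t) (at t within S)"
  using has_field_derivative_at_within[OF poly_DERIV[of p t]]
  by (simp add: has_real_derivative_iff_has_vector_derivative)

text \<open>The claim is kept on a whole interval because the next one-sided derivative at
  \<open>t\<close> depends on the previous one to the right of \<open>t\<close>. The end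
  \<open>z\<close> is left out: nothing is known about \<open>g\<close> beyond it.\<close>

lemma right_deriv_poly:
  assumes "\<forall>t\<in>{y..<z}. g t = poly p t"
  shows "\<forall>t\<in>{y..<z}. right_deriv k g t = poly ((pderiv ^^ k) p) t"
proof (induction k)
  case 0
  then show ?case using assms by (simp add: right_deriv_def)
next
  case (Suc k)
  show ?case
  proof
    fix t assume t: "t \<in> {y..<z}"
    then obtain s where s: "t < s" "s < z" using dense by auto
    have "(right_deriv k g has_vector_derivative poly ((pderiv ^^ Suc k) p) t) (at t within {t..s})"
      unfolding funpow_pderiv_Suc
      by (rule has_vector_derivative_transform[OF _ _ poly_has_vector_derivative]) (use t s Suc in simp_all)
    then have "(right_deriv k g has_vector_derivative poly ((pderiv ^^ Suc k) p) t) (at_right t)"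
      using s at_within_Icc_at_right[of t s] by simp
    then show "right_deriv (Suc k) g t = poly ((pderiv ^^ Suc k) p) t"
      using vector_derivative_within[of t "{t<..}"] trivial_limit_at_right_real[of t]
      by (simp add: right_deriv_def)
  qed
qed

lemma left_deriv_poly:
  assumes "\<forall>t\<in>{x<..y}. g t = poly p t"
  shows "\<forall>t\<in>{x<..y}. left_deriv k g t = poly ((pderiv ^^ k) p) t"
proof (induction k)
  case 0
  then show ?case using assms by (simp add: left_deriv_def)
next
  case (Suc k)
  show ?case
  proof
    fix t assume t: "t \<in> {x<..y}"
    then obtain s where s: "x < s" "s < t" using dense by auto
    have "(left_deriv k g has_vector_derivative poly ((pderiv ^^ Suc k) p) t) (at t within {s..t})"
      unfolding funpow_pderiv_Suc
      by (rule has_vector_derivative_transform[OF _ _ poly_has_vector_derivative]) (use t s Suc in simp_all)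
    then have "(left_deriv k g has_vector_derivative poly ((pderiv ^^ Suc k) p) t) (at_left t)"
      using s at_within_Icc_at_left[of s t] by simp
    then show "left_deriv (Suc k) g t = poly ((pderiv ^^ Suc k) p) t"
      using vector_derivative_within[of t "{..<t}"] trivial_limit_at_left_real[of t]
      by (simp add: left_deriv_def)
  qed
qed

text \<open>A derivative within a nondegenerate closed interval is unique even at its endpoints.
  Hence a chain of derivatives of a spline can be read off at an edge from either of the two
  adjacent pieces.\<close>

lemma iterated_derivative_poly:
  assumes "\<And>j t. j < b \<Longrightarrow> t \<in> S \<Longrightarrow> (G j has_real_derivative G (Suc j) t) (at t within S)"
    and "{y..z} \<subseteq> S" "y < z" "\<forall>t\<in>{y..z}. G 0 t = poly p t" "j \<le> b"
  shows "\<forall>t\<in>{y..z}. G j t = poly ((pderiv ^^ j) p) t"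
  using assms(5)
proof (induction j)
  case 0
  then show ?case using assms by simp
next
  case (Suc j)
  show ?case
  proof
    fix t assume t: "t \<in> {y..z}"
    have "(G j has_vector_derivative G (Suc j) t) (at t within {y..z})"
      unfolding has_real_derivative_iff_has_vector_derivative[symmetric]
      by (rule DERIV_subset[OF assms(1) assms(2)]) (use assms(2) Suc.prems t in auto)
    moreover have "(G j has_vector_derivative poly ((pderiv ^^ Suc j) p) t) (at t within {y..z})"
      unfolding funpow_pderiv_Suc
      by (rule has_vector_derivative_transform[OF _ _ poly_has_vector_derivative]) (use t Suc in auto)
    ultimately show "G (Suc j) t = poly ((pderiv ^^ Suc j) p) t"
      using vector_derivative_unique_within_closed_interval[of y z t "G j"] assms(3) t
      by (simp add: cbox_interval)
  qed
qed

text \<open>Taylor expansion at \<open>y\<close>, carried out by induction: the derivative satisfies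
  the same hypotheses for a smaller bound and vanishes, so \<open>p\<close> is a constant with value
  0 at \<open>y\<close>.\<close>

lemma poly_eq_0_if_derivs:
  fixes p :: "real poly"
  assumes "degree p \<le> d" "\<forall>j\<le>d. poly ((pderiv ^^ j) p) y = 0"
  shows "p = 0"
  using assms
proof (induction d arbitrary: p)
  case 0
  then show ?case by (auto elim!: degree_eq_zeroE)
next
  case (Suc d)
  have "poly ((pderiv ^^ j) (pderiv p)) y = 0" if "j \<le> d" for j
    using Suc.prems(2)[rule_format, of "Suc j"] that by (simp add: funpow_swap1)
  then have "pderiv p = 0"
    using Suc.prems(1) by (intro Suc.IH) (auto simp: degree_pderiv)
  then have "degree p = 0" by (simp add: pderiv_eq_0_iff)
  then show ?case using Suc.prems(2)[rule_format, of 0] by (auto elim!: degree_eq_zeroE)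
qed

lemma funpow_pderiv_diff: "(pderiv ^^ j) (p - q) = (pderiv ^^ j) p - (pderiv ^^ j) (q :: real poly)"
  by (induction j) (simp_all add: pderiv_diff)

text \<open>The one-dimensional core of edge elimination. The derivatives of the two pieces at
  \<open>y\<close> agree up to order \<open>d - 1\<close> because both are \<open>G j y\<close>, and
  in order \<open>d\<close> by the jump condition; a polynomial of degree at most \<open>d\<close>
  is determined by these values.\<close>

lemma poly_pieces_eq:
  assumes "d \<ge> 1"
    and G: "\<And>j t. j < d - 1 \<Longrightarrow> t \<in> S \<Longrightarrow> (G j has_real_derivative G (Suc j) t) (at t within S)"
    and S: "{w..y} \<subseteq> S" "{y..z} \<subseteq> S" "w < y" "y < z"
    and p: "\<forall>t\<in>{w..y}. G 0 t = poly p t" "degree p \<le> d"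
    and q: "\<forall>t\<in>{y..z}. G 0 t = poly q t" "degree q \<le> d"
    and jump: "right_deriv d (G 0) y = left_deriv d (G 0) y"
  shows "p = q"
proof -
  have "poly ((pderiv ^^ j) (p - q)) y = 0" if "j \<le> d" for j
  proof (cases "j = d")
    case True
    have "right_deriv d (G 0) y = poly ((pderiv ^^ d) q) y"
      using right_deriv_poly[of y z "G 0" q d] q S by auto
    moreover have "left_deriv d (G 0) y = poly ((pderiv ^^ d) p) y"
      using left_deriv_poly[of w y "G 0" p d] p S by auto
    ultimately show ?thesis using jump True by (simp add: funpow_pderiv_diff)
  next
    case False
    then have j: "j \<le> d - 1" using that by simp
    have "G j y = poly ((pderiv ^^ j) p) y"
      using iterated_derivative_poly[OF G S(1,3) p(1) j] S by auto
    moreover have "G j y = poly ((pderiv ^^ j) q) y"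
      using iterated_derivative_poly[OF G S(2,4) q(1) j] S by auto
    ultimately show ?thesis by (simp add: funpow_pderiv_diff)
  qed
  then have "p - q = 0"
    using poly_eq_0_if_derivs[of "p - q" d y] p(2) q(2) by (simp add: degree_diff_le)
  then show ?thesis by simp
qed

text \<open>Polynomial pieces are taken as functions on the whole plane, so that two pieces known on
  different cells can be compared by plain equality, without choosing coefficients.\<close>

definition bipolys :: "nat \<Rightarrow> nat \<Rightarrow> (real \<times> real \<Rightarrow> real) set" where
  "bipolys d1 d2 = {P. \<exists>a. \<forall>x y. P (x, y) = (\<Sum>i\<le>d1. \<Sum>j\<le>d2. a i j * x ^ i * y ^ j)}"

lemma bipoly_on_iff: "bipoly_on d1 d2 C f \<longleftrightarrow> (\<exists>P\<in>bipolys d1 d2. \<forall>z\<in>C. f z = P z)"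
proof
  assume "bipoly_on d1 d2 C f"
  then obtain a where a: "\<forall>(x, y)\<in>C. f (x, y) = (\<Sum>i\<le>d1. \<Sum>j\<le>d2. a i j * x ^ i * y ^ j)"
    unfolding bipoly_on_def by blast
  define P where "P = (\<lambda>(x, y). \<Sum>i\<le>d1. \<Sum>j\<le>d2. a i j * x ^ i * y ^ j)"
  have "P \<in> bipolys d1 d2" unfolding bipolys_def P_def by (intro CollectI exI[of _ a]) simp
  moreover have "f (x, y) = P (x, y)" if "(x, y) \<in> C" for x y
    using bspec[OF a that] unfolding P_def by simp
  ultimately show "\<exists>P\<in>bipolys d1 d2. \<forall>z\<in>C. f z = P z" by force
next
  assume "\<exists>P\<in>bipolys d1 d2. \<forall>z\<in>C. f z = P z"
  then obtain P where P: "P \<in> bipolys d1 d2" "\<forall>z\<in>C. f z = P z" by blast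
  then obtain a where "\<forall>x y. P (x, y) = (\<Sum>i\<le>d1. \<Sum>j\<le>d2. a i j * x ^ i * y ^ j)"
    unfolding bipolys_def by blast
  with P(2) show "bipoly_on d1 d2 C f" unfolding bipoly_on_def by (intro exI[of _ a] ballI) (clarify, simp)
qed

lemma bipolys_slice_x:
  assumes "P \<in> bipolys d1 d2"
  obtains p where "degree p \<le> d1" "\<And>x. P (x, y) = poly p x"
proof -
  obtain a where a: "\<And>x y. P (x, y) = (\<Sum>i\<le>d1. \<Sum>j\<le>d2. a i j * x ^ i * y ^ j)"
    using assms unfolding bipolys_def by blast
  have "degree (\<Sum>i\<le>d1. monom (\<Sum>j\<le>d2. a i j * y ^ j) i) \<le> d1"
    by (intro degree_sum_le) (auto intro: order_trans[OF degree_monom_le])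
  moreover have "P (x, y) = poly (\<Sum>i\<le>d1. monom (\<Sum>j\<le>d2. a i j * y ^ j) i) x" for x
    by (simp add: a poly_sum poly_monom sum_distrib_right sum_distrib_left mult_ac)
  ultimately show ?thesis by (rule that)
qed

lemma bipolys_slice_y:
  assumes "P \<in> bipolys d1 d2"
  obtains p where "degree p \<le> d2" "\<And>y. P (x, y) = poly p y"
proof -
  obtain a where a: "\<And>x y. P (x, y) = (\<Sum>i\<le>d1. \<Sum>j\<le>d2. a i j * x ^ i * y ^ j)"
    using assms unfolding bipolys_def by blast
  have "degree (\<Sum>j\<le>d2. monom (\<Sum>i\<le>d1. a i j * x ^ i) j) \<le> d2"
    by (intro degree_sum_le) (auto intro: order_trans[OF degree_monom_le])
  moreover have "P (x, y) = poly (\<Sum>j\<le>d2. monom (\<Sum>i\<le>d1. a i j * x ^ i) j) y" for y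
    unfolding a by (subst sum.swap) (simp add: poly_sum poly_monom sum_distrib_right)
  ultimately show ?thesis by (rule that)
qed

lemma poly_eq_on_interval:
  fixes p q :: "real poly"
  assumes "u < v" "\<And>t. u < t \<Longrightarrow> t < v \<Longrightarrow> poly p t = poly q t"
  shows "p = q"
proof (rule ccontr)
  assume "p \<noteq> q"
  then have "finite {t. poly (p - q) t = 0}" by (intro poly_roots_finite) simp
  moreover have "{u<..<v} \<subseteq> {t. poly (p - q) t = 0}" using assms by auto
  ultimately show False using assms(1) finite_subset infinite_Ioo by blast
qed

text \<open>The identity theorem for univariate polynomials is applied twice: first along vertical
  lines through the box, which gives equality on the whole vertical strip, then along every
  horizontal line.\<close>

lemma bipolys_eq_on_box:
  assumes P: "P \<in> bipolys d1 d2" and Q: "Q \<in> bipolys d1 d2" and "u < v" "c < d"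
    and eq: "\<And>x y. u < x \<Longrightarrow> x < v \<Longrightarrow> c < y \<Longrightarrow> y < d \<Longrightarrow> P (x, y) = Q (x, y)"
  shows "P = Q"
proof -
  have *: "P (x, y) = Q (x, y)" if x: "u < x" "x < v" for x y
  proof -
    obtain p where p: "\<And>y. P (x, y) = poly p y" using bipolys_slice_y[OF P] by metis
    obtain q where q: "\<And>y. Q (x, y) = poly q y" using bipolys_slice_y[OF Q] by metis
    have "p = q" using poly_eq_on_interval[OF \<open>c < d\<close>, of p q] eq x p q by metis
    then show ?thesis by (simp add: p q)
  qed
  have "P (x, y) = Q (x, y)" for x y
  proof -
    obtain p where p: "\<And>x. P (x, y) = poly p x" using bipolys_slice_x[OF P] by metis
    obtain q where q: "\<And>x. Q (x, y) = poly q x" using bipolys_slice_x[OF Q] by metis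
    have "p = q" using poly_eq_on_interval[OF \<open>u < v\<close>, of p q] * p q by metis
    then show ?thesis by (simp add: p q)
  qed
  then show ?thesis by (simp add: fun_eq_iff)
qed

lemma bipolys_eq_on_open:
  assumes P: "P \<in> bipolys d1 d2" and Q: "Q \<in> bipolys d1 d2"
    and "open U" "U \<noteq> {}" "\<And>z. z \<in> U \<Longrightarrow> P z = Q z"
  shows "P = Q"
proof -
  obtain x y where "(x, y) \<in> U" using assms(4) by auto
  then obtain A B where AB: "open A" "open B" "(x, y) \<in> A \<times> B" "A \<times> B \<subseteq> U"
    by (rule open_prod_elim[OF assms(3)]) blast
  have "x \<in> A" "y \<in> B" using AB(3) by auto
  then obtain a b where ab: "a > 0" "ball x a \<subseteq> A" "b > 0" "ball y b \<subseteq> B"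
    using AB(1,2) by (meson openE)
  have "P (s, t) = Q (s, t)" if "x - a < s" "s < x + a" "y - b < t" "t < y + b" for s t
  proof -
    have "s \<in> ball x a" "t \<in> ball y b" using that by (simp_all add: dist_real_def abs_less_iff)
    then have "(s, t) \<in> A \<times> B" using ab(2,4) by blast
    then show ?thesis using AB(4) assms(5) by blast
  qed
  then show ?thesis
    using ab(1,3) by (intro bipolys_eq_on_box[OF P Q, of "x - a" "x + a" "y - b" "y + b"]) auto
qed

text \<open>\<open>poly_pieces_eq\<close> on the vertical line through \<open>x\<close>, with the
  pure derivatives \<open>D 0 j\<close> of the smoothness class as the chain \<open>G\<close>. The
  order \<open>d2 - 1\<close> of smoothness is exactly what lies below the order of the
  jump.\<close>

lemma bipolys_match_y:
  assumes "d2 \<ge> 1" and C: "C_class a (d2 - 1) \<Omega> f"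
    and P: "P \<in> bipolys d1 d2" and Q: "Q \<in> bipolys d1 d2"
    and S: "{x} \<times> {w..y} \<subseteq> \<Omega>" "{x} \<times> {y..z} \<subseteq> \<Omega>" "w < y" "y < z"
    and f: "\<And>t. t \<in> {w..y} \<Longrightarrow> f (x, t) = P (x, t)" "\<And>t. t \<in> {y..z} \<Longrightarrow> f (x, t) = Q (x, t)"
    and jump: "right_deriv d2 (\<lambda>t. f (x, t)) y = left_deriv d2 (\<lambda>t. f (x, t)) y"
  shows "P (x, t) = Q (x, t)"
proof -
  obtain D where D0: "D 0 0 = f" and D':
    "\<forall>i\<le>a. \<forall>j<d2 - 1. \<forall>(x, y)\<in>\<Omega>. ((\<lambda>t. D i j (x, t)) has_real_derivative D i (Suc j) (x, y)) (at y within {t. (x, t) \<in> \<Omega>})"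
    using C unfolding C_class_def by (elim exE conjE) (rule that)
  have D: "((\<lambda>t. D 0 j (x, t)) has_real_derivative D 0 (Suc j) (x, s)) (at s within {t. (x, t) \<in> \<Omega>})"
    if "j < d2 - 1" "(x, s) \<in> \<Omega>" for j s
    using D'[rule_format, of 0 j "(x, s)"] that by simp
  obtain p where p: "degree p \<le> d2" "\<And>y. P (x, y) = poly p y" using bipolys_slice_y[OF P] by metis
  obtain q where q: "degree q \<le> d2" "\<And>y. Q (x, y) = poly q y" using bipolys_slice_y[OF Q] by metis
  \<comment> \<open>Both pieces are restricted to the line; \<open>D0\<close> identifies the start
    of the chain with the slice of \<open>f\<close>.\<close>
  have "p = q"
    by (rule poly_pieces_eq[where d = d2 and S = "{t. (x, t) \<in> \<Omega>}" and G = "\<lambda>j t. D 0 j (x, t)"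
          and w = w and y = y and z = z]) (use assms(1) D D0 S p q f jump in auto)
  then show ?thesis by (simp add: p q)
qed

lemma bipolys_match_x:
  assumes "d1 \<ge> 1" and C: "C_class (d1 - 1) b \<Omega> f"
    and P: "P \<in> bipolys d1 d2" and Q: "Q \<in> bipolys d1 d2"
    and S: "{w..x} \<times> {y} \<subseteq> \<Omega>" "{x..z} \<times> {y} \<subseteq> \<Omega>" "w < x" "x < z"
    and f: "\<And>t. t \<in> {w..x} \<Longrightarrow> f (t, y) = P (t, y)" "\<And>t. t \<in> {x..z} \<Longrightarrow> f (t, y) = Q (t, y)"
    and jump: "right_deriv d1 (\<lambda>t. f (t, y)) x = left_deriv d1 (\<lambda>t. f (t, y)) x"
  shows "P (t, y) = Q (t, y)"
proof -
  obtain D where D0: "D 0 0 = f" and D':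
    "\<forall>i<d1 - 1. \<forall>j\<le>b. \<forall>(x, y)\<in>\<Omega>. ((\<lambda>t. D i j (t, y)) has_real_derivative D (Suc i) j (x, y)) (at x within {t. (t, y) \<in> \<Omega>})"
    using C unfolding C_class_def by (elim exE conjE) (rule that)
  have D: "((\<lambda>t. D j 0 (t, y)) has_real_derivative D (Suc j) 0 (s, y)) (at s within {t. (t, y) \<in> \<Omega>})"
    if "j < d1 - 1" "(s, y) \<in> \<Omega>" for j s
    using D'[rule_format, of j 0 "(s, y)"] that by simp
  obtain p where p: "degree p \<le> d1" "\<And>x. P (x, y) = poly p x" using bipolys_slice_x[OF P] by metis
  obtain q where q: "degree q \<le> d1" "\<And>x. Q (x, y) = poly q x" using bipolys_slice_x[OF Q] by metis
  have "p = q"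
    by (rule poly_pieces_eq[where d = d1 and S = "{t. (t, y) \<in> \<Omega>}" and G = "\<lambda>j t. D j 0 (t, y)"
          and w = w and y = x and z = z]) (use assms(1) D D0 S p q f jump in auto)
  then show ?thesis by (simp add: p q)
qed

subsection \<open>Refinement of meshes\<close>

lemma edges_cases:
  assumes "e \<in> edges T"
  obtains
    (horizontal) u v y where "u < v" "e = {u..v} \<times> {y}" "e \<subseteq> grid T"
      "{u<..<v} \<times> {y} \<inter> vertices T = {}"
  | (vertical) u v x where "u < v" "e = {x} \<times> {u..v}" "e \<subseteq> grid T"
      "{x} \<times> {u<..<v} \<inter> vertices T = {}"
proof -
  obtain p q where e: "e = closed_segment p q" and pq: "p \<noteq> q" "fst p = fst q \<or> snd p = snd q"
    "e \<subseteq> grid T" "open_segment p q \<inter> vertices T = {}"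
    using assms unfolding edges_def by blast
  obtain p1 p2 q1 q2 where p: "p = (p1, p2)" and q: "q = (q1, q2)" by (cases p, cases q)
  consider "p2 = q2" "p1 < q1" | "p2 = q2" "q1 < p1" | "p1 = q1" "p2 < q2" | "p1 = q1" "q2 < p2"
    using pq(1,2) p q by force
  then show ?thesis
  proof cases
    case 1
    show ?thesis
      using e pq(3,4) horizontal_segment[OF 1(2), of q2] unfolding p q 1
      by (intro horizontal[OF 1(2)]) auto
  next
    case 2
    show ?thesis
      using e pq(3,4) horizontal_segment[OF 2(2), of q2] unfolding p q 2
      by (intro horizontal[OF 2(2)]) (auto simp: closed_segment_commute open_segment_commute)
  next
    case 3
    show ?thesis
      using e pq(3,4) vertical_segment[OF 3(2), of q1] unfolding p q 3
      by (intro vertical[OF 3(2)]) auto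
  next
    case 4
    show ?thesis
      using e pq(3,4) vertical_segment[OF 4(2), of q1] unfolding p q 4
      by (intro vertical[OF 4(2)]) (auto simp: closed_segment_commute open_segment_commute)
  qed
qed

lemma edges_subset_grid: "e \<in> edges T \<Longrightarrow> e \<subseteq> grid T"
  unfolding edges_def by blast

lemma horizontal_Times_singleton [simp]: "horizontal (S \<times> {y})"
  by (auto simp: horizontal_def)

lemma not_horizontal_vertical:
  assumes "u < v"
  shows "\<not> horizontal ({x} \<times> {u..v})"
proof
  assume "horizontal ({x} \<times> {u..v})"
  then obtain k where k: "\<And>t. t \<in> {u..v} \<Longrightarrow> t = k" unfolding horizontal_def by fastforce
  from k[of u] k[of v] assms show False by simp
qed

locale mesh_refinement =
  fixes T T' :: mesh
  assumes coarse: "T_mesh T" and fine: "T_mesh T'"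
    and domain_eq: "\<Union>T' = \<Union>T" and grid_mono: "grid T \<subseteq> grid T'"
begin

text \<open>The interior of a fine cell is connected and misses the coarse grid, so it lies in the
  interior of one coarse cell; taking closures gives the cell itself.\<close>

lemma cell_subset_cell:
  assumes "D \<in> T'"
  shows "\<exists>C\<in>T. D \<subseteq> C"
proof -
  note D = T_mesh_cell[OF fine assms]
  have "interior D \<subseteq> \<Union>T" using assms interior_subset domain_eq by blast
  moreover have "interior D \<inter> grid T = {}"
    using grid_disjoint_interior[OF fine assms] grid_mono by blast
  ultimately obtain C where C: "C \<in> T" "interior D \<subseteq> interior C"
    using connected_subset_interior[OF coarse cell_interior_connected[OF D] cell_interior_nonempty[OF D]]
    by blast
  then have "D \<subseteq> C"
    using closure_mono[OF C(2)] cell_closure_interior[OF D]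
      cell_closure_interior[OF T_mesh_cell[OF coarse C(1)]] by simp
  with C(1) show ?thesis by blast
qed

text \<open>A fine cell through an interior point of \<open>C\<close> lies in some coarse cell,
  which must be \<open>C\<close>. So the fine cells inside \<open>C\<close> cover its interior, and
  their union is closed because they are finitely many.\<close>

lemma cell_eq_Union:
  assumes "C \<in> T"
  shows "C = \<Union>{D \<in> T'. D \<subseteq> C}"
proof
  let ?U = "\<Union>{D \<in> T'. D \<subseteq> C}"
  have "interior C \<subseteq> ?U"
  proof
    fix p assume p: "p \<in> interior C"
    then have "p \<in> \<Union>T'" using assms interior_subset domain_eq by blast
    then obtain D where D: "D \<in> T'" "p \<in> D" by blast
    then obtain C' where "C' \<in> T" "D \<subseteq> C'" using cell_subset_cell by blast
    moreover from this have "C' = C" using cell_unique[OF coarse assms _ p] D by blast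
    ultimately show "p \<in> ?U" using D by blast
  qed
  moreover have "closed ?U"
    using T_mesh_finite[OF fine] cell_closed[OF T_mesh_cell[OF fine]] by (intro closed_Union) auto
  ultimately have "closure (interior C) \<subseteq> ?U" by (rule closure_minimal)
  then show "C \<subseteq> ?U" using cell_closure_interior[OF T_mesh_cell[OF coarse assms]] by simp
qed blast

lemma vertices_mono: "vertices T \<subseteq> vertices T'"
proof (rule subrelI)
  fix x y assume "(x, y) \<in> vertices T"
  then obtain a b c d where C: "a < b" "c < d" "{a..b} \<times> {c..d} \<in> T" "x \<in> {a, b}" "y \<in> {c, d}"
    unfolding vertices_def by blast
  then have "(x, y) \<in> {a..b} \<times> {c..d}" by auto
  then obtain D where D: "D \<in> T'" "D \<subseteq> {a..b} \<times> {c..d}" "(x, y) \<in> D"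
    using cell_eq_Union[OF C(3)] by blast
  obtain a' b' c' d' where D': "a' < b'" "c' < d'" "D = {a'..b'} \<times> {c'..d'}"
    using T_mesh_cell[OF fine D(1)] unfolding cell_def by blast
  \<comment> \<open>Two opposite corners of \<open>D\<close> suffice to bound \<open>D\<close> by
    \<open>C\<close>. An extreme coordinate of \<open>C\<close> attained in \<open>D\<close> is then
    extreme in \<open>D\<close> as well.\<close>
  then have "(a', c') \<in> D" "(b', d') \<in> D" by auto
  then have "(a', c') \<in> {a..b} \<times> {c..d}" "(b', d') \<in> {a..b} \<times> {c..d}" using D(2) by blast+
  then have "x = a' \<or> x = b'" "y = c' \<or> y = d'" using C D(3) unfolding D'(3) by auto
  then show "(x, y) \<in> vertices T'" using D(1) D' by (intro vertices_rectangleI[of a' b' c' d']) auto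
qed

text \<open>The key is that the relative interior of the edge avoids the coarse grid. A common point
  is no vertex, so it lies inside a side of a coarse cell. On a horizontal side, a coarse edge would
  contain the whole fine edge, contradicting that it is extended; a vertical side would cross the
  fine edge in a vertex of \<open>T'\<close>.\<close>

lemma horizontal_extended_edge:
  assumes e: "{u..v} \<times> {y} \<in> extended_edges T T'" and uv: "u < v"
    and nv: "{u<..<v} \<times> {y} \<inter> vertices T' = {}"
  obtains a b c d where "{a..b} \<times> {c..d} \<in> T" "{u..v} \<subseteq> {a..b}" "c < y" "y < d"
proof -
  have e': "{u..v} \<times> {y} \<in> edges T'" "\<And>e'. e' \<in> edges T \<Longrightarrow> \<not> {u..v} \<times> {y} \<subseteq> e'"
    using e unfolding extended_edges_def by blast+
  have "(x, y) \<notin> grid T" if x: "u < x" "x < v" for x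
  proof
    assume "(x, y) \<in> grid T"
    then obtain a b c d where C: "{a..b} \<times> {c..d} \<in> T" "a < b" "c < d"
      "(x, y) \<in> {a..b} \<times> {c..d}" and side: "x = a \<or> x = b \<or> y = c \<or> y = d"
      using grid_rectangleE[OF coarse] by metis
    have nvx: "(x, y) \<notin> vertices T'" using nv x by (auto simp: disjoint_iff)
    then have nvx': "(x, y) \<notin> vertices T" using vertices_mono by blast
    then have "\<not> ((x = a \<or> x = b) \<and> (y = c \<or> y = d))"
      using vertices_rectangleI[OF C(1-3)] by blast
    then consider "y = c \<or> y = d" "a < x" "x < b" | "x = a \<or> x = b" "c < y" "y < d"
      using C(4) side by force
    then show False
    proof cases
      case 1
      obtain u' v' where uv': "{u'..v'} \<times> {y} \<in> edges T" "u' < x" "x < v'"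
        "(u', y) \<in> vertices T" "(v', y) \<in> vertices T"
        using horizontal_side_edge[OF coarse C(1,3) 1 nvx'] by metis
      \<comment> \<open>Coarse vertices are fine vertices, and a fine edge has none in its relative
        interior. So the coarse edge cannot end inside the fine one.\<close>
      have "(u', y) \<notin> {u<..<v} \<times> {y}" "(v', y) \<notin> {u<..<v} \<times> {y}"
        using uv'(4,5) vertices_mono nv by blast+
      then have "u' \<le> u" "v \<le> v'" using uv'(2,3) x by auto
      then have "{u..v} \<times> {y} \<subseteq> {u'..v'} \<times> {y}" by auto
      with e'(2)[OF uv'(1)] show False by blast
    next
      case 2
      have "{x} \<times> {c..d} \<subseteq> grid T" using 2(1) C by (auto intro!: grid_rectangleI[OF C(1)])
      then have "{x} \<times> {c..d} \<subseteq> grid T'" using grid_mono by blast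
      with crossing_is_vertex[OF fine x edges_subset_grid[OF e'(1)] 2(2,3)] nvx show False by blast
    qed
  qed
  then have "{u<..<v} \<times> {y} \<inter> grid T = {}" by auto
  moreover have "{u<..<v} \<times> {y} \<subseteq> {u..v} \<times> {y}" by auto
  then have "{u<..<v} \<times> {y} \<subseteq> \<Union>T"
    using edges_subset_grid[OF e'(1)] grid_subset_Union[OF fine] domain_eq by blast
  moreover have "connected ({u<..<v} \<times> {y})" by (intro connected_Times) auto
  moreover have "{u<..<v} \<times> {y} \<noteq> {}" using uv by auto
  ultimately obtain C where C: "C \<in> T" "{u<..<v} \<times> {y} \<subseteq> interior C"
    using connected_subset_interior[OF coarse] by meson
  obtain a b c d where abcd: "C = {a..b} \<times> {c..d}"
    using T_mesh_cell[OF coarse C(1)] unfolding cell_def by blast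
  have "{u<..<v} \<times> {y} \<subseteq> {a<..<b} \<times> {c<..<d}"
    using C(2) unfolding abcd interior_rectangle .
  \<comment> \<open>The bounds on \<open>y\<close> are read off at some point of the open interval,
    which \<open>dense\<close> supplies.\<close>
  then have "{u<..<v} \<subseteq> {a<..<b}" "c < y" "y < d" using uv dense[OF uv] by (auto simp: subset_iff)
  then show ?thesis using C(1) uv unfolding abcd
    by (intro that[of a b c d]) (auto simp: greaterThanLessThan_subseteq_greaterThanLessThan)
qed

lemma vertical_extended_edge:
  assumes e: "{x} \<times> {u..v} \<in> extended_edges T T'" and uv: "u < v"
    and nv: "{x} \<times> {u<..<v} \<inter> vertices T' = {}"
  obtains a b c d where "{a..b} \<times> {c..d} \<in> T" "{u..v} \<subseteq> {c..d}" "a < x" "x < b"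
proof -
  have e': "{x} \<times> {u..v} \<in> edges T'" "\<And>e'. e' \<in> edges T \<Longrightarrow> \<not> {x} \<times> {u..v} \<subseteq> e'"
    using e unfolding extended_edges_def by blast+
  have "(x, y) \<notin> grid T" if y: "u < y" "y < v" for y
  proof
    assume "(x, y) \<in> grid T"
    then obtain a b c d where C: "{a..b} \<times> {c..d} \<in> T" "a < b" "c < d"
      "(x, y) \<in> {a..b} \<times> {c..d}" and side: "x = a \<or> x = b \<or> y = c \<or> y = d"
      using grid_rectangleE[OF coarse] by metis
    have nvx: "(x, y) \<notin> vertices T'" using nv y by (auto simp: disjoint_iff)
    then have nvx': "(x, y) \<notin> vertices T" using vertices_mono by blast
    then have "\<not> ((x = a \<or> x = b) \<and> (y = c \<or> y = d))"
      using vertices_rectangleI[OF C(1-3)] by blast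
    then consider "x = a \<or> x = b" "c < y" "y < d" | "y = c \<or> y = d" "a < x" "x < b"
      using C(4) side by force
    then show False
    proof cases
      case 1
      obtain u' v' where uv': "{x} \<times> {u'..v'} \<in> edges T" "u' < y" "y < v'"
        "(x, u') \<in> vertices T" "(x, v') \<in> vertices T"
        using vertical_side_edge[OF coarse C(1,2) 1 nvx'] by metis
      have "(x, u') \<notin> {x} \<times> {u<..<v}" "(x, v') \<notin> {x} \<times> {u<..<v}"
        using uv'(4,5) vertices_mono nv by blast+
      then have "u' \<le> u" "v \<le> v'" using uv'(2,3) y by auto
      then have "{x} \<times> {u..v} \<subseteq> {x} \<times> {u'..v'}" by auto
      with e'(2)[OF uv'(1)] show False by blast
    next
      case 2
      have "{a..b} \<times> {y} \<subseteq> grid T" using 2(1) C by (auto intro!: grid_rectangleI[OF C(1)])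
      then have "{a..b} \<times> {y} \<subseteq> grid T'" using grid_mono by blast
      with crossing_is_vertex[OF fine 2(2,3) _ y edges_subset_grid[OF e'(1)]] nvx show False by blast
    qed
  qed
  then have "{x} \<times> {u<..<v} \<inter> grid T = {}" by auto
  moreover have "{x} \<times> {u<..<v} \<subseteq> {x} \<times> {u..v}" by auto
  then have "{x} \<times> {u<..<v} \<subseteq> \<Union>T"
    using edges_subset_grid[OF e'(1)] grid_subset_Union[OF fine] domain_eq by blast
  moreover have "connected ({x} \<times> {u<..<v})" by (intro connected_Times) auto
  moreover have "{x} \<times> {u<..<v} \<noteq> {}" using uv by auto
  ultimately obtain C where C: "C \<in> T" "{x} \<times> {u<..<v} \<subseteq> interior C"
    using connected_subset_interior[OF coarse] by meson
  obtain a b c d where abcd: "C = {a..b} \<times> {c..d}"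
    using T_mesh_cell[OF coarse C(1)] unfolding cell_def by blast
  have "{x} \<times> {u<..<v} \<subseteq> {a<..<b} \<times> {c<..<d}"
    using C(2) unfolding abcd interior_rectangle .
  then have "{u<..<v} \<subseteq> {c<..<d}" "a < x" "x < b" using uv dense[OF uv] by (auto simp: subset_iff)
  then show ?thesis using C(1) uv unfolding abcd
    by (intro that[of a b c d]) (auto simp: greaterThanLessThan_subseteq_greaterThanLessThan)
qed

text \<open>The form in which jumps are evaluated: at every point of the edge, its endpoints
  included, one coarse cell extends strictly to both sides in the direction of
  differentiation.\<close>

lemma extended_edge_cases:
  assumes "e \<in> extended_edges T T'"
  obtains
    (horizontal) a b c d where "horizontal e" "{a..b} \<times> {c..d} \<in> T"
      "\<And>x y. (x, y) \<in> e \<Longrightarrow> a \<le> x \<and> x \<le> b \<and> c < y \<and> y < d"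
  | (vertical) a b c d where "\<not> horizontal e" "{a..b} \<times> {c..d} \<in> T"
      "\<And>x y. (x, y) \<in> e \<Longrightarrow> a < x \<and> x < b \<and> c \<le> y \<and> y \<le> d"
proof -
  have "e \<in> edges T'" using assms unfolding extended_edges_def by blast
  then show ?thesis
  proof (cases rule: edges_cases)
    case (horizontal u v y)
    show ?thesis
    proof (rule horizontal_extended_edge[OF assms[unfolded horizontal(2)] horizontal(1,4)])
      fix a b c d assume *: "{a..b} \<times> {c..d} \<in> T" "{u..v} \<subseteq> {a..b}" "c < y" "y < d"
      show ?thesis
        by (rule that(1)[OF _ *(1)]) (use horizontal(2) *(2-) in auto)
    qed
  next
    case (vertical u v x)
    show ?thesis
    proof (rule vertical_extended_edge[OF assms[unfolded vertical(2)] vertical(1,4)])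
      fix a b c d assume *: "{a..b} \<times> {c..d} \<in> T" "{u..v} \<subseteq> {c..d}" "a < x" "x < b"
      show ?thesis
        by (rule that(2)[OF _ *(1)])
          (use vertical(2) not_horizontal_vertical[OF vertical(1)] *(2-) in auto)
    qed
  qed
qed

lemma extended_edgeI:
  assumes "e \<in> edges T'" "p \<in> e" "p \<notin> grid T"
  shows "e \<in> extended_edges T T'"
  using assms edges_subset_grid unfolding extended_edges_def by blast

end

subsection \<open>Jumps of splines\<close>

lemma poly_funpow_pderiv_add_smult:
  "poly ((pderiv ^^ k) (p + smult c q)) y =
    poly ((pderiv ^^ k) p) y + c * poly ((pderiv ^^ k) (q :: real poly)) y"
proof -
  have "(pderiv ^^ k) (p + smult c q) = (pderiv ^^ k) p + smult c ((pderiv ^^ k) q)"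
    by (induction k) (simp_all add: pderiv_add pderiv_smult)
  then show ?thesis by simp
qed

text \<open>\<open>vector_derivative\<close> is total and selects its value by choice, so
  \<open>right_deriv\<close> is not linear on arbitrary functions. Being a polynomial just to the
  right of \<open>y\<close> is a condition closed under combinations that makes it linear.\<close>

definition right_poly :: "(real \<Rightarrow> real) \<Rightarrow> real \<Rightarrow> bool" where
  "right_poly g y \<longleftrightarrow> (\<exists>p z. y < z \<and> (\<forall>t\<in>{y..<z}. g t = poly p t))"

definition left_poly :: "(real \<Rightarrow> real) \<Rightarrow> real \<Rightarrow> bool" where
  "left_poly g y \<longleftrightarrow> (\<exists>p z. z < y \<and> (\<forall>t\<in>{z<..y}. g t = poly p t))"

lemma right_poly_add_mult:
  assumes "right_poly g y" "right_poly h y"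
  shows "right_poly (\<lambda>t. g t + c * h t) y"
    and "right_deriv k (\<lambda>t. g t + c * h t) y = right_deriv k g y + c * right_deriv k h y"
proof -
  obtain p u q v where p: "y < u" "\<forall>t\<in>{y..<u}. g t = poly p t"
    and q: "y < v" "\<forall>t\<in>{y..<v}. h t = poly q t"
    using assms unfolding right_poly_def by blast
  define z where "z = min u v"
  have z: "y < z" "\<forall>t\<in>{y..<z}. g t = poly p t" "\<forall>t\<in>{y..<z}. h t = poly q t"
    using p q by (simp_all add: z_def)
  then have gh: "\<forall>t\<in>{y..<z}. g t + c * h t = poly (p + smult c q) t" by simp
  with z(1) show "right_poly (\<lambda>t. g t + c * h t) y" unfolding right_poly_def by blast
  show "right_deriv k (\<lambda>t. g t + c * h t) y = right_deriv k g y + c * right_deriv k h y"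
    using right_deriv_poly[OF gh, of k] right_deriv_poly[OF z(2), of k] right_deriv_poly[OF z(3), of k] z(1)
    by (simp add: poly_funpow_pderiv_add_smult)
qed

lemma left_poly_add_mult:
  assumes "left_poly g y" "left_poly h y"
  shows "left_poly (\<lambda>t. g t + c * h t) y"
    and "left_deriv k (\<lambda>t. g t + c * h t) y = left_deriv k g y + c * left_deriv k h y"
proof -
  obtain p u q v where p: "u < y" "\<forall>t\<in>{u<..y}. g t = poly p t"
    and q: "v < y" "\<forall>t\<in>{v<..y}. h t = poly q t"
    using assms unfolding left_poly_def by blast
  define z where "z = max u v"
  have z: "z < y" "\<forall>t\<in>{z<..y}. g t = poly p t" "\<forall>t\<in>{z<..y}. h t = poly q t"
    using p q by (simp_all add: z_def)
  then have gh: "\<forall>t\<in>{z<..y}. g t + c * h t = poly (p + smult c q) t" by simp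
  with z(1) show "left_poly (\<lambda>t. g t + c * h t) y" unfolding left_poly_def by blast
  show "left_deriv k (\<lambda>t. g t + c * h t) y = left_deriv k g y + c * left_deriv k h y"
    using left_deriv_poly[OF gh, of k] left_deriv_poly[OF z(2), of k] left_deriv_poly[OF z(3), of k] z(1)
    by (simp add: poly_funpow_pderiv_add_smult)
qed

text \<open>Both conclusions are proved together: splitting off the last summand requires that the
  partial sum is again a polynomial to the right of \<open>y\<close>.\<close>

lemma right_deriv_sum:
  fixes n :: nat
  assumes "\<And>j. j < n \<Longrightarrow> right_poly (g j) y"
  shows "right_poly (\<lambda>t. \<Sum>j<n. c j * g j t) y \<and>
    right_deriv k (\<lambda>t. \<Sum>j<n. c j * g j t) y = (\<Sum>j<n. c j * right_deriv k (g j) y)"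
  using assms
proof (induction n)
  case 0
  have "\<forall>t\<in>{y..<y + 1}. (0::real) = poly 0 t" by simp
  moreover have "(pderiv ^^ k) 0 = (0 :: real poly)" by (induction k) auto
  ultimately show ?case
    using right_deriv_poly[of y "y + 1" "\<lambda>t. 0" 0 k] unfolding right_poly_def
    by (auto intro!: exI[of _ "0 :: real poly"] exI[of _ "y + 1"])
next
  case (Suc n)
  then show ?case
    using right_poly_add_mult[where g = "\<lambda>t. \<Sum>j<n. c j * g j t" and y = y and h = "g n" and c = "c n"] by simp
qed

lemma left_deriv_sum:
  fixes n :: nat
  assumes "\<And>j. j < n \<Longrightarrow> left_poly (g j) y"
  shows "left_poly (\<lambda>t. \<Sum>j<n. c j * g j t) y \<and>
    left_deriv k (\<lambda>t. \<Sum>j<n. c j * g j t) y = (\<Sum>j<n. c j * left_deriv k (g j) y)"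
  using assms
proof (induction n)
  case 0
  have "\<forall>t\<in>{y - 1<..y}. (0::real) = poly 0 t" by simp
  moreover have "(pderiv ^^ k) 0 = (0 :: real poly)" by (induction k) auto
  ultimately show ?case
    using left_deriv_poly[of "y - 1" y "\<lambda>t. 0" 0 k] unfolding left_poly_def
    by (auto intro!: exI[of _ "0 :: real poly"] exI[of _ "y - 1"])
next
  case (Suc n)
  then show ?case
    using left_poly_add_mult[where g = "\<lambda>t. \<Sum>j<n. c j * g j t" and y = y and h = "g n" and c = "c n"] by simp
qed

text \<open>The start may be a vertex or lie on the grid: some single cell still contains an initial
  piece of the ray. The four slice lemmas below are its instances for the axis directions.\<close>

lemma piecewise_poly_along_ray:
  assumes T: "T_mesh T" and f: "\<And>C. C \<in> T \<Longrightarrow> bipoly_on d1 d2 C f" and "\<delta> > 0"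
    and "\<And>t. 0 \<le> t \<Longrightarrow> t \<le> \<delta> \<Longrightarrow> (x + t * v, y + t * w) \<in> \<Union>T"
  obtains P \<epsilon> where "P \<in> bipolys d1 d2" "\<epsilon> > 0"
    "\<And>t. 0 \<le> t \<Longrightarrow> t \<le> \<epsilon> \<Longrightarrow> f (x + t * v, y + t * w) = P (x + t * v, y + t * w)"
proof -
  obtain D \<epsilon> where D: "D \<in> T" "\<epsilon> > 0" "\<forall>t\<in>{0..\<epsilon>}. (x, y) + t *\<^sub>R (v, w) \<in> D"
    using ray_in_cell[OF T_mesh_finite[OF T] T_mesh_cell[OF T] assms(3), of "(x, y)" "(v, w)"] assms(4)
    by auto
  obtain P where "P \<in> bipolys d1 d2" "\<forall>z\<in>D. f z = P z"
    using f[OF D(1)] unfolding bipoly_on_iff by blast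
  with D show ?thesis by (intro that[of P \<epsilon>]) auto
qed

lemma slice_right_poly_y:
  assumes T: "T_mesh T" and f: "\<And>C. C \<in> T \<Longrightarrow> bipoly_on d1 d2 C f"
    and z: "y < z" "{x} \<times> {y..z} \<subseteq> \<Union>T"
  shows "right_poly (\<lambda>t. f (x, t)) y"
proof -
  have "(x + t * 0, y + t * 1) \<in> \<Union>T" if "0 \<le> t" "t \<le> z - y" for t
    by (rule subsetD[OF z(2)]) (use that in auto)
  then obtain P \<epsilon> where P: "P \<in> bipolys d1 d2" "\<epsilon> > 0"
      "\<And>t. 0 \<le> t \<Longrightarrow> t \<le> \<epsilon> \<Longrightarrow> f (x + t * 0, y + t * 1) = P (x + t * 0, y + t * 1)"
    using piecewise_poly_along_ray[OF T f, of "z - y" x 0 y 1] z(1) by (metis diff_gt_0_iff_gt)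
  obtain p where p: "\<And>y. P (x, y) = poly p y" using bipolys_slice_y[OF P(1)] by metis
  have "f (x, t) = poly p t" if "t \<in> {y..<y + \<epsilon>}" for t
    using P(3)[of "t - y"] that p by auto
  then show ?thesis unfolding right_poly_def using P(2)
    by (intro exI[of _ p] exI[of _ "y + \<epsilon>"]) auto
qed

lemma slice_left_poly_y:
  assumes T: "T_mesh T" and f: "\<And>C. C \<in> T \<Longrightarrow> bipoly_on d1 d2 C f"
    and z: "z < y" "{x} \<times> {z..y} \<subseteq> \<Union>T"
  shows "left_poly (\<lambda>t. f (x, t)) y"
proof -
  have "(x + t * 0, y + t * (-1)) \<in> \<Union>T" if "0 \<le> t" "t \<le> y - z" for t
    by (rule subsetD[OF z(2)]) (use that in auto)
  then obtain P \<epsilon> where P: "P \<in> bipolys d1 d2" "\<epsilon> > 0"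
      "\<And>t. 0 \<le> t \<Longrightarrow> t \<le> \<epsilon> \<Longrightarrow> f (x + t * 0, y + t * (-1)) = P (x + t * 0, y + t * (-1))"
    using piecewise_poly_along_ray[OF T f, of "y - z" x 0 y "-1"] z(1) by (metis diff_gt_0_iff_gt)
  obtain p where p: "\<And>y. P (x, y) = poly p y" using bipolys_slice_y[OF P(1)] by metis
  have "f (x, t) = poly p t" if "t \<in> {y - \<epsilon><..y}" for t
    using P(3)[of "y - t"] that p by auto
  then show ?thesis unfolding left_poly_def using P(2)
    by (intro exI[of _ p] exI[of _ "y - \<epsilon>"]) auto
qed

lemma slice_right_poly_x:
  assumes T: "T_mesh T" and f: "\<And>C. C \<in> T \<Longrightarrow> bipoly_on d1 d2 C f"
    and z: "x < z" "{x..z} \<times> {y} \<subseteq> \<Union>T"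
  shows "right_poly (\<lambda>t. f (t, y)) x"
proof -
  have "(x + t * 1, y + t * 0) \<in> \<Union>T" if "0 \<le> t" "t \<le> z - x" for t
    by (rule subsetD[OF z(2)]) (use that in auto)
  then obtain P \<epsilon> where P: "P \<in> bipolys d1 d2" "\<epsilon> > 0"
      "\<And>t. 0 \<le> t \<Longrightarrow> t \<le> \<epsilon> \<Longrightarrow> f (x + t * 1, y + t * 0) = P (x + t * 1, y + t * 0)"
    using piecewise_poly_along_ray[OF T f, of "z - x" x 1 y 0] z(1) by (metis diff_gt_0_iff_gt)
  obtain p where p: "\<And>x. P (x, y) = poly p x" using bipolys_slice_x[OF P(1)] by metis
  have "f (t, y) = poly p t" if "t \<in> {x..<x + \<epsilon>}" for t
    using P(3)[of "t - x"] that p by auto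
  then show ?thesis unfolding right_poly_def using P(2)
    by (intro exI[of _ p] exI[of _ "x + \<epsilon>"]) auto
qed

lemma slice_left_poly_x:
  assumes T: "T_mesh T" and f: "\<And>C. C \<in> T \<Longrightarrow> bipoly_on d1 d2 C f"
    and z: "z < x" "{z..x} \<times> {y} \<subseteq> \<Union>T"
  shows "left_poly (\<lambda>t. f (t, y)) x"
proof -
  have "(x + t * (-1), y + t * 0) \<in> \<Union>T" if "0 \<le> t" "t \<le> x - z" for t
    by (rule subsetD[OF z(2)]) (use that in auto)
  then obtain P \<epsilon> where P: "P \<in> bipolys d1 d2" "\<epsilon> > 0"
      "\<And>t. 0 \<le> t \<Longrightarrow> t \<le> \<epsilon> \<Longrightarrow> f (x + t * (-1), y + t * 0) = P (x + t * (-1), y + t * 0)"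
    using piecewise_poly_along_ray[OF T f, of "x - z" x "-1" y 0] z(1) by (metis diff_gt_0_iff_gt)
  obtain p where p: "\<And>x. P (x, y) = poly p x" using bipolys_slice_x[OF P(1)] by metis
  have "f (t, y) = poly p t" if "t \<in> {x - \<epsilon><..x}" for t
    using P(3)[of "x - t"] that p by auto
  then show ?thesis unfolding left_poly_def using P(2)
    by (intro exI[of _ p] exI[of _ "x - \<epsilon>"]) auto
qed

lemma spline_space_bipoly_on: "f \<in> spline_space d1 d2 T \<Longrightarrow> C \<in> T \<Longrightarrow> bipoly_on d1 d2 C f"
  by (simp add: spline_space_def)

section \<open>Comparison of the spline spaces of the two meshes\<close>

context mesh_refinement
begin

lemma spline_space_mono: "spline_space d1 d2 T \<subseteq> spline_space d1 d2 T'"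
proof
  fix f assume f: "f \<in> spline_space d1 d2 T"
  have "bipoly_on d1 d2 D f" if D: "D \<in> T'" for D
  proof -
    obtain C where "C \<in> T" "D \<subseteq> C" using cell_subset_cell[OF D] by blast
    then show ?thesis using spline_space_bipoly_on[OF f, of C] unfolding bipoly_on_def by blast
  qed
  then show "f \<in> spline_space d1 d2 T'" using f domain_eq by (simp add: spline_space_def)
qed

text \<open>Row by row, this identifies the linear system with the vanishing of the jumps of the
  combination. It rests on linearity of one-sided derivatives for the slices of the
  \<open>B j\<close>, which are polynomials on either side of \<open>p\<close>.\<close>

lemma jump_sum:
  fixes n :: nat
  assumes e: "e \<in> extended_edges T T'" and p: "p \<in> e"
    and B: "\<And>j. j < n \<Longrightarrow> B j \<in> spline_space d1 d2 T'"
  shows "jump d1 d2 e (\<Sum>j<n. c j *\<^sub>R B j) p = (\<Sum>j<n. jump d1 d2 e (B j) p * c j)"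
proof -
  obtain x y where xy: "p = (x, y)" by (cases p)
  have app: "(\<Sum>j<n. c j *\<^sub>R B j) q = (\<Sum>j<n. c j * B j q)" for q
    by (induction n) auto
  note bp = spline_space_bipoly_on[OF B]
  from e show ?thesis
  proof (cases rule: extended_edge_cases)
    case (horizontal a b c' d)
    then have pos: "a \<le> x" "x \<le> b" "c' < y" "y < d" using p xy by auto
    \<comment> \<open>The coarse cell guarantees room above and below \<open>p\<close> in the
      domain; the polynomial pieces of the slices come from fine cells.\<close>
    have sub: "{a..b} \<times> {c'..d} \<subseteq> \<Union>T'" using horizontal(2) domain_eq by blast
    have "{x} \<times> {y..d} \<subseteq> \<Union>T'" "{x} \<times> {c'..y} \<subseteq> \<Union>T'"
      using pos by (auto intro!: subset_trans[OF _ sub])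
    then have "right_poly (\<lambda>t. B j (x, t)) y" "left_poly (\<lambda>t. B j (x, t)) y" if "j < n" for j
      using slice_right_poly_y[OF fine bp[OF that]] slice_left_poly_y[OF fine bp[OF that]] pos
      by blast+
    then show ?thesis using horizontal(1)
      by (simp add: xy app right_deriv_sum left_deriv_sum sum_subtractf algebra_simps)
  next
    case (vertical a b c' d)
    then have pos: "a < x" "x < b" "c' \<le> y" "y \<le> d" using p xy by auto
    have sub: "{a..b} \<times> {c'..d} \<subseteq> \<Union>T'" using vertical(2) domain_eq by blast
    have "{x..b} \<times> {y} \<subseteq> \<Union>T'" "{a..x} \<times> {y} \<subseteq> \<Union>T'"
      using pos by (auto intro!: subset_trans[OF _ sub])
    then have "right_poly (\<lambda>t. B j (t, y)) x" "left_poly (\<lambda>t. B j (t, y)) x" if "j < n" for j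
      using slice_right_poly_x[OF fine bp[OF that]] slice_left_poly_x[OF fine bp[OF that]] pos
      by blast+
    then show ?thesis using vertical(1)
      by (simp add: xy app right_deriv_sum left_deriv_sum sum_subtractf algebra_simps)
  qed
qed

text \<open>Near \<open>p\<close>, both sides of the slice lie in one coarse cell, so both one-sided
  derivatives are taken of the same polynomial.\<close>

lemma jump_eq_0:
  assumes e: "e \<in> extended_edges T T'" and p: "p \<in> e" and f: "f \<in> spline_space d1 d2 T"
  shows "jump d1 d2 e f p = 0"
proof -
  obtain x y where xy: "p = (x, y)" by (cases p)
  from e show ?thesis
  proof (cases rule: extended_edge_cases)
    case (horizontal a b c d)
    then have pos: "a \<le> x" "x \<le> b" "c < y" "y < d" using p xy by auto
    obtain P where P: "P \<in> bipolys d1 d2" "\<forall>z\<in>{a..b} \<times> {c..d}. f z = P z"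
      using spline_space_bipoly_on[OF f horizontal(2)] unfolding bipoly_on_iff by blast
    obtain q where q: "\<And>y. P (x, y) = poly q y" using bipolys_slice_y[OF P(1)] by metis
    have "\<forall>t\<in>{y..<d}. f (x, t) = poly q t" "\<forall>t\<in>{c<..y}. f (x, t) = poly q t"
      using P(2) q pos by auto
    from right_deriv_poly[OF this(1), of d2] left_deriv_poly[OF this(2), of d2]
    show ?thesis using horizontal(1) pos by (simp add: xy)
  next
    case (vertical a b c d)
    then have pos: "a < x" "x < b" "c \<le> y" "y \<le> d" using p xy by auto
    obtain P where P: "P \<in> bipolys d1 d2" "\<forall>z\<in>{a..b} \<times> {c..d}. f z = P z"
      using spline_space_bipoly_on[OF f vertical(2)] unfolding bipoly_on_iff by blast
    obtain q where q: "\<And>x. P (x, y) = poly q x" using bipolys_slice_x[OF P(1)] by metis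
    have "\<forall>t\<in>{x..<b}. f (t, y) = poly q t" "\<forall>t\<in>{a<..x}. f (t, y) = poly q t"
      using P(2) q pos by auto
    from right_deriv_poly[OF this(1), of d1] left_deriv_poly[OF this(2), of d1]
    show ?thesis using vertical(1) pos by (simp add: xy)
  qed
qed

text \<open>The point \<open>m\<close> lies inside a fine cell or inside facing sides of two fine
  cells. In the second case the zero jump makes the two pieces agree along all nearby lines
  perpendicular to the side, hence everywhere.\<close>

lemma locally_bipoly:
  assumes d: "d1 \<ge> 1" "d2 \<ge> 1" and f: "f \<in> spline_space d1 d2 T'"
    and jump: "\<And>e p. e \<in> extended_edges T T' \<Longrightarrow> p \<in> e \<Longrightarrow> jump d1 d2 e f p = 0"
    and C: "C \<in> T" and m: "m \<in> interior C" "m \<notin> vertices T'"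
  shows "\<exists>P\<in>bipolys d1 d2. \<exists>U. open U \<and> m \<in> U \<and> (\<forall>z\<in>U. f z = P z)"
proof -
  obtain x y where xy: "m = (x, y)" by (cases m)
  have sm: "C_class (d1 - 1) (d2 - 1) (\<Union>T') f"
    using f by (simp add: spline_space_def)
  have "(x, y) \<in> interior (\<Union>T')"
    using m(1) xy domain_eq interior_mono[OF Union_upper[OF C]] by auto
  moreover have nv: "(x, y) \<notin> vertices T'" using m xy by simp
  \<comment> \<open>Consequently any fine edge through \<open>m\<close> is an extended edge.\<close>
  moreover have ng: "(x, y) \<notin> grid T" using grid_disjoint_interior[OF coarse C] m xy by blast
  ultimately show ?thesis
  proof (cases rule: interior_point_cases[OF fine, consumes 2, case_names inside horizontal vertical])
    case (inside D)
    obtain P where "P \<in> bipolys d1 d2" "\<forall>z\<in>D. f z = P z"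
      using spline_space_bipoly_on[OF f inside(1)] unfolding bipoly_on_iff by blast
    then show ?thesis using inside(2) xy interior_subset[of D]
      by (intro bexI[of _ P] exI[of _ "interior D"]) auto
  next
    case (horizontal a b c a' b' d)
    obtain P where P: "P \<in> bipolys d1 d2" "\<And>z. z \<in> {a..b} \<times> {c..y} \<Longrightarrow> f z = P z"
      using spline_space_bipoly_on[OF f horizontal(1)] unfolding bipoly_on_iff by blast
    obtain Q where Q: "Q \<in> bipolys d1 d2" "\<And>z. z \<in> {a'..b'} \<times> {y..d} \<Longrightarrow> f z = Q z"
      using spline_space_bipoly_on[OF f horizontal(2)] unfolding bipoly_on_iff by blast
    obtain u v where uv: "{u..v} \<times> {y} \<in> edges T'" "u < x" "x < v"
      using horizontal_side_edge[OF fine horizontal(1,7) _ horizontal(3,4) nv] by metis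
    have "(x, y) \<in> {u..v} \<times> {y}" using uv by auto
    then have e: "{u..v} \<times> {y} \<in> extended_edges T T'"
      using extended_edgeI[OF uv(1) _ ng] by blast
    \<comment> \<open>The range over which the edge and the sides of both cells overlap; it contains
      \<open>x\<close> in its interior.\<close>
    define l r where "l = max u (max a a')" and "r = min v (min b b')"
    have lr: "l < x" "x < r" "u \<le> l" "a \<le> l" "a' \<le> l" "r \<le> v" "r \<le> b" "r \<le> b'"
      using horizontal uv by (auto simp: l_def r_def)
    have "P (s, t) = Q (s, t)" if s: "l < s" "s < r" for s t
    proof -
      have in1: "{s} \<times> {c..y} \<subseteq> {a..b} \<times> {c..y}" and in2: "{s} \<times> {y..d} \<subseteq> {a'..b'} \<times> {y..d}"
        using s lr by auto
      have "(s, y) \<in> {u..v} \<times> {y}" using s lr by auto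
      from jump[OF e this] have "right_deriv d2 (\<lambda>t. f (s, t)) y = left_deriv d2 (\<lambda>t. f (s, t)) y"
        by simp
      then show ?thesis
        using in1 in2 horizontal(1,2) P(2) Q(2)
        by (intro bipolys_match_y[OF d(2) sm P(1) Q(1) _ _ horizontal(7,8)]) blast+
    qed
    then have "P = Q"
      \<comment> \<open>The pieces agree on full vertical lines, so the interval from 0 to 1 is an
        arbitrary choice.\<close>
      by (intro bipolys_eq_on_box[OF P(1) Q(1), of l r 0 1]) (use lr in auto)
    have "f z = P z" if "z \<in> {l<..<r} \<times> {c<..<d}" for z
    proof -
      have "z \<in> {a..b} \<times> {c..y} \<or> z \<in> {a'..b'} \<times> {y..d}" using that lr by auto
      then show ?thesis using P(2) Q(2) \<open>P = Q\<close> by blast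
    qed
    moreover have "m \<in> {l<..<r} \<times> {c<..<d}" using lr horizontal xy by auto
    ultimately show ?thesis using P(1)
      by (intro bexI[of _ P] exI[of _ "{l<..<r} \<times> {c<..<d}"]) (auto intro: open_Times)
  next
    case (vertical a c d b c' d')
    obtain P where P: "P \<in> bipolys d1 d2" "\<And>z. z \<in> {a..x} \<times> {c..d} \<Longrightarrow> f z = P z"
      using spline_space_bipoly_on[OF f vertical(1)] unfolding bipoly_on_iff by blast
    obtain Q where Q: "Q \<in> bipolys d1 d2" "\<And>z. z \<in> {x..b} \<times> {c'..d'} \<Longrightarrow> f z = Q z"
      using spline_space_bipoly_on[OF f vertical(2)] unfolding bipoly_on_iff by blast
    obtain u v where uv: "{x} \<times> {u..v} \<in> edges T'" "u < y" "y < v"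
      using vertical_side_edge[OF fine vertical(1,7) _ vertical(3,4) nv] by metis
    have "(x, y) \<in> {x} \<times> {u..v}" using uv by auto
    then have e: "{x} \<times> {u..v} \<in> extended_edges T T'"
      using extended_edgeI[OF uv(1) _ ng] by blast
    define l r where "l = max u (max c c')" and "r = min v (min d d')"
    have lr: "l < y" "y < r" "u \<le> l" "c \<le> l" "c' \<le> l" "r \<le> v" "r \<le> d" "r \<le> d'"
      using vertical uv by (auto simp: l_def r_def)
    have "P (t, s) = Q (t, s)" if s: "l < s" "s < r" for s t
    proof -
      have in1: "{a..x} \<times> {s} \<subseteq> {a..x} \<times> {c..d}" and in2: "{x..b} \<times> {s} \<subseteq> {x..b} \<times> {c'..d'}"
        using s lr by auto
      have "(x, s) \<in> {x} \<times> {u..v}" using s lr by auto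
      from jump[OF e this] have "right_deriv d1 (\<lambda>t. f (t, s)) x = left_deriv d1 (\<lambda>t. f (t, s)) x"
        using not_horizontal_vertical[of u v x] uv by simp
      then show ?thesis
        using in1 in2 vertical(1,2) P(2) Q(2)
        by (intro bipolys_match_x[OF d(1) sm P(1) Q(1) _ _ vertical(7,8)]) blast+
    qed
    then have "P = Q"
      by (intro bipolys_eq_on_box[OF P(1) Q(1), of 0 1 l r]) (use lr in auto)
    have "f z = P z" if "z \<in> {a<..<b} \<times> {l<..<r}" for z
    proof -
      have "z \<in> {a..x} \<times> {c..d} \<or> z \<in> {x..b} \<times> {c'..d'}" using that lr by auto
      then show ?thesis using P(2) Q(2) \<open>P = Q\<close> by blast
    qed
    moreover have "m \<in> {a<..<b} \<times> {l<..<r}" using lr vertical xy by auto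
    ultimately show ?thesis using P(1)
      by (intro bexI[of _ P] exI[of _ "{a<..<b} \<times> {l<..<r}"]) (auto intro: open_Times)
  qed
qed

text \<open>The local polynomial \<open>P m\<close> is locally constant in \<open>m\<close>, since
  two polynomials agreeing on a nonempty open set are equal. On the connected set \<open>A\<close>
  it is therefore constant, and the fine cells carry the result over to the vertices and to the
  frontier of \<open>C\<close>.\<close>

lemma bipoly_on_if_jumps_eq_0:
  assumes d: "d1 \<ge> 1" "d2 \<ge> 1" and f: "f \<in> spline_space d1 d2 T'"
    and jump: "\<And>e p. e \<in> extended_edges T T' \<Longrightarrow> p \<in> e \<Longrightarrow> jump d1 d2 e f p = 0"
    and C: "C \<in> T"
  shows "bipoly_on d1 d2 C f"
proof -
  define A where "A = interior C - vertices T'"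
  have "\<forall>m\<in>A. \<exists>P U. P \<in> bipolys d1 d2 \<and> open U \<and> m \<in> U \<and> (\<forall>z\<in>U. f z = P z)"
    using locally_bipoly[OF d f jump C] unfolding A_def by blast
  then obtain P U where PU: "\<forall>m\<in>A. P m \<in> bipolys d1 d2 \<and> open (U m) \<and> m \<in> U m \<and> (\<forall>z\<in>U m. f z = P m z)"
    unfolding bchoice_iff by (elim exE) (rule that)
  then have P: "\<And>m. m \<in> A \<Longrightarrow> P m \<in> bipolys d1 d2"
    and U: "\<And>m. m \<in> A \<Longrightarrow> open (U m)" "\<And>m. m \<in> A \<Longrightarrow> m \<in> U m"
    and fP: "\<And>m z. m \<in> A \<Longrightarrow> z \<in> U m \<Longrightarrow> f z = P m z"
    by blast+
  \<comment> \<open>Deleting finitely many points from a connected open set of the plane leaves it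
    connected.\<close>
  have "connected A"
    unfolding A_def using cell_interior_connected[OF T_mesh_cell[OF coarse C]] finite_vertices[OF fine]
    by (intro connected_open_delete_finite) auto
  moreover have "P m = P m'" if m: "m \<in> A" and m': "m' \<in> A" "m' \<in> U m" for m m'
  proof (rule bipolys_eq_on_open[OF P[OF m] P[OF m'(1)]])
    show "open (U m \<inter> U m')" using m m' U by (intro open_Int)
    show "U m \<inter> U m' \<noteq> {}" using m' U(2) by blast
    show "P m z = P m' z" if "z \<in> U m \<inter> U m'" for z
      using fP[OF m, of z] fP[OF m'(1), of z] that by simp
  qed
  then have "\<forall>m\<in>A. eventually (\<lambda>m'. P m = P m') (at m within A)"
    unfolding eventually_at_topological using U by (intro ballI exI[of _ "U _"]) blast
  ultimately have const: "P m = P m'" if "m \<in> A" "m' \<in> A" for m m'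
    using connected_local_const[of A m m' P] that by blast
  \<comment> \<open>An interior point of \<open>D\<close> is no vertex and so belongs to
    \<open>A\<close>. The polynomial there agrees with the piece \<open>Q\<close> on an open set,
    and \<open>Q\<close> represents \<open>f\<close> on all of the closed cell.\<close>
  have on_subcell: "\<exists>m\<in>A. \<forall>z\<in>D. f z = P m z" if D: "D \<in> T'" "D \<subseteq> C" for D
  proof -
    note cD = T_mesh_cell[OF fine D(1)]
    obtain m where m: "m \<in> interior D" using cell_interior_nonempty[OF cD] by blast
    then have mA: "m \<in> A"
      using interior_mono[OF D(2)] grid_disjoint_interior[OF fine D(1)] vertices_subset_grid[of T']
      unfolding A_def by blast
    obtain Q where Q: "Q \<in> bipolys d1 d2" "\<forall>z\<in>D. f z = Q z"
      using spline_space_bipoly_on[OF f D(1)] unfolding bipoly_on_iff by blast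
    have eq: "P m z = Q z" if "z \<in> U m \<inter> interior D" for z
    proof -
      have "z \<in> D" using that interior_subset[of D] by blast
      then show ?thesis using fP[OF mA, of z] Q(2) that by auto
    qed
    have "P m = Q"
      by (rule bipolys_eq_on_open[OF P[OF mA] Q(1) _ _ eq, where U = "U m \<inter> interior D"])
        (use m U[OF mA] in \<open>blast intro: open_Int open_interior\<close>)+
    with Q(2) mA show ?thesis by blast
  qed
  have subcell: "\<exists>D\<in>T'. D \<subseteq> C \<and> z \<in> D" if "z \<in> C" for z
    using subsetD[OF equalityD1[OF cell_eq_Union[OF C]] that] by blast
  obtain z0 where "z0 \<in> C"
    using cell_interior_nonempty[OF T_mesh_cell[OF coarse C]] interior_subset by blast
  then obtain m0 where m0: "m0 \<in> A"
    using subcell on_subcell by blast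
  have "f z = P m0 z" if z: "z \<in> C" for z
  proof -
    obtain D where "D \<in> T'" "D \<subseteq> C" "z \<in> D" using subcell[OF z] by blast
    moreover from this obtain m where "m \<in> A" "\<forall>z\<in>D. f z = P m z" using on_subcell by blast
    ultimately show ?thesis using const[OF m0, of m] by simp
  qed
  then show ?thesis using P[OF m0] unfolding bipoly_on_iff by blast
qed

text \<open>Smoothness and vanishing outside are conditions on the common domain, so the two spaces
  differ only in the cells on which \<open>f\<close> has to be a polynomial.\<close>

lemma spline_space_iff_jumps:
  assumes "d1 \<ge> 1" "d2 \<ge> 1"
  shows "f \<in> spline_space d1 d2 T \<longleftrightarrow> f \<in> spline_space d1 d2 T' \<and>
    (\<forall>e\<in>extended_edges T T'. \<forall>p\<in>e. jump d1 d2 e f p = 0)"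
proof
  assume "f \<in> spline_space d1 d2 T"
  then show "f \<in> spline_space d1 d2 T' \<and> (\<forall>e\<in>extended_edges T T'. \<forall>p\<in>e. jump d1 d2 e f p = 0)"
    using spline_space_mono jump_eq_0 by blast
next
  assume f: "f \<in> spline_space d1 d2 T' \<and> (\<forall>e\<in>extended_edges T T'. \<forall>p\<in>e. jump d1 d2 e f p = 0)"
  then have "bipoly_on d1 d2 C f" if "C \<in> T" for C
    using bipoly_on_if_jumps_eq_0[OF assms _ _ that, of f] by blast
  with f show "f \<in> spline_space d1 d2 T" using domain_eq by (simp add: spline_space_def)
qed

end

subsection \<open>Bases and coordinates\<close>

lemma basis_family_image:
  assumes "linear \<Phi>" "inj_on \<Phi> V" "basis_family h c V"
  shows "basis_family h (\<lambda>j. \<Phi> (c j)) (\<Phi> ` V)"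
proof -
  have c: "inj_on c {..<h}" "independent (c ` {..<h})" "span (c ` {..<h}) = V"
    using assms(3) unfolding basis_family_def by auto
  have inj: "inj_on \<Phi> (span (c ` {..<h}))" using assms(2) c(3) by simp
  have im: "(\<lambda>j. \<Phi> (c j)) ` {..<h} = \<Phi> ` c ` {..<h}" by (simp add: image_image)
  have "inj_on (\<lambda>j. \<Phi> (c j)) {..<h}"
    using comp_inj_on[OF c(1) inj_on_subset[OF inj span_superset]] by (simp add: comp_def)
  moreover have "independent (\<Phi> ` c ` {..<h})"
    using linear_independent_injective_image[OF assms(1) c(2) inj] .
  moreover have "span (\<Phi> ` c ` {..<h}) = \<Phi> ` V"
    using linear_span_image[OF assms(1), of "c ` {..<h}"] c(3) by simp
  ultimately show ?thesis unfolding basis_family_def im by blast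
qed

lemma basis_family_dim:
  assumes "basis_family h b V"
  shows "dim V = h"
proof -
  have b: "inj_on b {..<h}" "independent (b ` {..<h})" "span (b ` {..<h}) = V"
    using assms unfolding basis_family_def by auto
  have "dim V = card (b ` {..<h})"
    using dim_span_eq_card_independent[OF b(2)] b(3) by simp
  then show ?thesis using b(1) by (simp add: card_image)
qed

lemma basis_family_combination_inj:
  assumes "basis_family n B V"
  shows "inj_on (\<lambda>c. \<Sum>i<n. c i *\<^sub>R B i) {c. \<forall>j\<ge>n. c j = 0}"
proof (rule inj_onI)
  fix c c' :: "nat \<Rightarrow> real"
  assume z: "c \<in> {c. \<forall>j\<ge>n. c j = 0}" "c' \<in> {c. \<forall>j\<ge>n. c j = 0}"
    and eq: "(\<Sum>i<n. c i *\<^sub>R B i) = (\<Sum>i<n. c' i *\<^sub>R B i)"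
  have B: "inj_on B {..<n}" "independent (B ` {..<n})"
    using assms unfolding basis_family_def by auto
  \<comment> \<open>Independence of a set speaks of coefficients attached to vectors; injectivity of
    \<open>B\<close> allows moving the indexed coefficients there.\<close>
  define u where "u v = c (the_inv_into {..<n} B v) - c' (the_inv_into {..<n} B v)" for v
  have "(\<Sum>v\<in>B ` {..<n}. u v *\<^sub>R v) = (\<Sum>i<n. (c i - c' i) *\<^sub>R B i)"
    by (simp add: sum.reindex[OF B(1)] u_def the_inv_into_f_f[OF B(1)])
  also have "\<dots> = 0" using eq by (simp add: scaleR_diff_left sum_subtractf)
  finally have "\<forall>v\<in>B ` {..<n}. u v = 0"
    using independentD[OF B(2) _ subset_refl, of u] by blast
  then have "c i = c' i" if "i < n" for i
    using that by (simp add: u_def the_inv_into_f_f[OF B(1)])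
  moreover have "c i = c' i" if "\<not> i < n" for i using z that by simp
  ultimately show "c = c'" by blast
qed

lemma basis_family_representation:
  assumes "basis_family n B V" "f \<in> V"
  obtains c where "\<forall>j\<ge>n. c j = 0" "f = (\<Sum>i<n. c i *\<^sub>R B i)"
proof -
  have B: "inj_on B {..<n}" "f \<in> span (B ` {..<n})"
    using assms unfolding basis_family_def by auto
  then obtain u where "f = (\<Sum>v\<in>B ` {..<n}. u v *\<^sub>R v)"
    by (auto simp: span_finite)
  then show ?thesis
    \<comment> \<open>The value 0 from index \<open>n\<close> on makes the function a coordinate
      vector with \<open>n\<close> entries.\<close>
    by (intro that[of "\<lambda>i. if i < n then u (B i) else 0"]) (simp_all add: sum.reindex[OF B(1)])
qed

theorem theorem3:
  fixes T T' :: mesh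
    and d1 d2 s n h :: nat
    and e :: "nat \<Rightarrow> (real \<times> real) set"
    and B :: "nat \<Rightarrow> real \<times> real \<Rightarrow> real"
    and c :: "nat \<Rightarrow> nat \<Rightarrow> real"
  assumes "d1 \<ge> 1" and "d2 \<ge> 1"
    and "T_mesh T" and "is_extension T T'"
    and "bij_betw e {..<s} (extended_edges T T')"
    and "n = dim (spline_space d1 d2 T')"
    and "basis_family n B (spline_space d1 d2 T')"
    and "basis_family h c (EEE_solutions d1 d2 s e n B)"
  shows "basis_family h (\<lambda>j. \<Sum>i<n. c j i *\<^sub>R B i) (spline_space d1 d2 T) \<and>
         h = dim (spline_space d1 d2 T)"
proof -
  interpret mesh_refinement T T'
    using assms(3,4) by unfold_locales (auto simp: is_extension_def)
  let ?\<Phi> = "\<lambda>c. \<Sum>i<n. c i *\<^sub>R B i" and ?E = "EEE_solutions d1 d2 s e n B"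
  have span_B: "span (B ` {..<n}) = spline_space d1 d2 T'"
    using assms(7) by (simp add: basis_family_def)
  then have B: "B j \<in> spline_space d1 d2 T'" if "j < n" for j
    using span_base[of "B j" "B ` {..<n}"] that by auto
  have \<Phi>_mem: "?\<Phi> c \<in> spline_space d1 d2 T'" for c
    unfolding span_B[symmetric] by (intro span_sum span_scale span_base) auto
  have edges_e: "extended_edges T T' = e ` {..<s}"
    using assms(5) by (simp add: bij_betw_def)
  \<comment> \<open>Since \<open>e\<close> enumerates all extended edges, the rows together say that
    every jump of \<open>?\<Phi> c\<close> vanishes, which characterizes the coarse splines among
    the fine ones.\<close>
  have E: "c \<in> ?E \<longleftrightarrow> (\<forall>j\<ge>n. c j = 0) \<and> ?\<Phi> c \<in> spline_space d1 d2 T" for c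
  proof -
    have "(\<Sum>j<n. EEE_matrix d1 d2 e B i j p * c j) = jump d1 d2 (e i) (?\<Phi> c) p"
      if "i < s" "p \<in> e i" for i p
      using jump_sum[OF _ that(2) B, where c = c] that(1) edges_e
      by (simp add: EEE_matrix_def)
    then show ?thesis
      using spline_space_iff_jumps[OF assms(1,2), of "?\<Phi> c"] \<Phi>_mem[of c]
      by (auto simp: EEE_solutions_def edges_e)
  qed
  have "?\<Phi> ` ?E = spline_space d1 d2 T"
  proof
    \<comment> \<open>Surjectivity: a coarse spline is also a fine spline, so it has coordinates in
      \<open>B\<close>, and by \<open>E\<close> these solve the system.\<close>
    show "spline_space d1 d2 T \<subseteq> ?\<Phi> ` ?E"
    proof
      fix f assume f: "f \<in> spline_space d1 d2 T"
      then have "f \<in> spline_space d1 d2 T'" using spline_space_mono by blast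
      then obtain c where "\<forall>j\<ge>n. c j = 0" "f = ?\<Phi> c"
        by (rule basis_family_representation[OF assms(7)])
      with f E show "f \<in> ?\<Phi> ` ?E" by blast
    qed
  qed (use E in blast)
  moreover have "linear ?\<Phi>"
    by (intro linearI) (simp_all add: scaleR_add_left sum.distrib scaleR_sum_right)
  moreover have "inj_on ?\<Phi> ?E"
    by (rule inj_on_subset[OF basis_family_combination_inj[OF assms(7)]]) (auto simp: EEE_solutions_def)
  ultimately have "basis_family h (\<lambda>j. ?\<Phi> (c j)) (spline_space d1 d2 T)"
    using basis_family_image[of ?\<Phi> ?E h c] assms(8) by simp
  then show ?thesis using basis_family_dim by blast
qed

end
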